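(* Let $n>1$ be a positive integer coprime with $6$ and let $a$ be an indeterminate. Then \[ \sum_{k=0}^{(n-1)/2}[8k+1] \frac{(aq, q/a;q^2)_k\, (q;q^2)_{2k}\, (q,q^2;q^6)_k} {(q^2;q^2)_{2k}\,(aq^6, q^6/a;q^6)_k\, (q;q)_{2k} }\, q^{2k} \equiv \begin{cases} 0 \pmod{\Phi_n(q)}, &\text{if } n\equiv 1\pmod 6,\\ 0 \pmod{\Phi_n(q)(1-aq^n)(a-q^n)}, &\text{if } n\equiv 5\pmod 6. \end{cases} \]
   Context: Here $q$ and $a$ are indeterminates. For $x$ and a base $p$ (a power of $q$), $(x;p)_k=\prod_{j=0}^{k-1}(1-xp^j)$ and $(x_1,\dots,x_m;p)_k=(x_1;p)_k\cdots(x_m;p)_k$. The $q$-integer is $[j]=1+q+\cdots+q^{j-1}$ and $\Phi_n(q)$ is the $n$-th cyclotomic polynomial. For rational functions $A,B$ in $q,a$ and a polynomial $P$, $A\equiv B\pmod{P}$ means that the numerator of the reduced form of $A-B$ is divisible by $P$ in the polynomial ring over $\mathbb{Z}$ in these variables. *)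

theory Defs
  imports
    Complex_Main
    "HOL-Computational_Algebra.Computational_Algebra"
    "HOL-Number_Theory.Cong"
begin

definition primitive_roots_unity :: "nat \<Rightarrow> complex set" where
  "primitive_roots_unity n = {z. z ^ n = 1 \<and> (\<forall>m. 0 < m \<and> m < n \<longrightarrow> z ^ m \<noteq> 1)}"

definition cyclotomic_complex :: "nat \<Rightarrow> complex poly" where
  "cyclotomic_complex n = (\<Prod>z\<in>primitive_roots_unity n. [:-z, 1:])"

text \<open>
  The product over the primitive roots has integer coefficients; the integer polynomial is the
  version used below. That the description is well defined is shown in
  \<open>of_int_cyclotomic\<close>.
\<close>

definition cyclotomic :: "nat \<Rightarrow> int poly" where
  "cyclotomic n = (THE p. map_poly of_int p = cyclotomic_complex n)"

lemma map_poly_of_int_mult: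
  "map_poly (of_int :: int \<Rightarrow> complex) (p * q) = map_poly of_int p * map_poly of_int q"
  by (intro poly_eqI) (simp add: coeff_map_poly coeff_mult)

lemma map_poly_of_int_add:
  "map_poly (of_int :: int \<Rightarrow> complex) (p + q) = map_poly of_int p + map_poly of_int q"
  by (intro poly_eqI) (simp add: coeff_map_poly)

lemma map_poly_of_int_prod:
  "map_poly (of_int :: int \<Rightarrow> complex) (prod f A) = (\<Prod>x\<in>A. map_poly of_int (f x))"
  by (induction A rule: infinite_finite_induct) (simp_all add: map_poly_of_int_mult)

lemma map_poly_of_int_inj:
  "map_poly (of_int :: int \<Rightarrow> complex) p = map_poly of_int q \<Longrightarrow> p = q"
  by (auto simp: poly_eq_iff coeff_map_poly)

lemma degree_map_poly_of_int:
  "degree (map_poly (of_int :: int \<Rightarrow> complex) p) = degree p"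
  by (rule degree_map_poly) auto

lemma finite_primitive_roots_unity: "n > 0 \<Longrightarrow> finite (primitive_roots_unity n)"
  by (rule finite_subset[OF _ finite_roots_unity[of n]]) (auto simp: primitive_roots_unity_def)

lemma roots_unity_decompose:
  assumes "n > 0"
  shows "{z::complex. z ^ n = 1} = (\<Union>d\<in>{d. d dvd n}. primitive_roots_unity d)"
proof (intro equalityI subsetI)
  fix z :: complex assume z: "z \<in> {z. z ^ n = 1}"
  define d where "d = (LEAST d. d > 0 \<and> z ^ d = 1)"
  have d: "d > 0" "z ^ d = 1"
    using LeastI[of "\<lambda>d. d > 0 \<and> z ^ d = 1" n] z assms by (auto simp: d_def)
  have min: "z ^ m \<noteq> 1" if "0 < m" "m < d" for m
    using not_less_Least[of m "\<lambda>d. d > 0 \<and> z ^ d = 1"] that by (auto simp: d_def)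
  have "z ^ n = (z ^ d) ^ (n div d) * z ^ (n mod d)"
    by (simp flip: power_mult power_add)
  hence "z ^ (n mod d) = 1"
    using z d by simp
  hence "n mod d = 0"
    using min[of "n mod d"] d by auto
  hence "d dvd n" by auto
  moreover have "z \<in> primitive_roots_unity d"
    using d min by (auto simp: primitive_roots_unity_def)
  ultimately show "z \<in> (\<Union>d\<in>{d. d dvd n}. primitive_roots_unity d)" by blast
next
  fix z assume "z \<in> (\<Union>d\<in>{d. d dvd n}. primitive_roots_unity d)"
  then obtain d where "d dvd n" "z ^ d = 1"
    by (auto simp: primitive_roots_unity_def)
  then show "z \<in> {z. z ^ n = 1}"
    by (auto simp: power_mult)
qed

lemma primitive_roots_unity_disjoint:
  assumes "d > 0" "e > 0" "d \<noteq> e"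
  shows "primitive_roots_unity d \<inter> primitive_roots_unity e = {}"
  using assms by (auto simp: primitive_roots_unity_def dest: linorder_neqE_nat)

lemma prod_roots_unity:
  assumes "n > 0"
  shows "(\<Prod>z | z ^ n = 1. [:-z, 1:]) = (monom 1 n - 1 :: complex poly)"
proof -
  let ?p = "monom 1 n - 1 :: complex poly"
  have deg: "degree ?p = n"
    using degree_add_eq_left[of "-1" "monom (1::complex) n"] assms by (simp add: degree_monom_eq)
  have "rsquarefree ?p"
    unfolding rsquarefree_roots
    using assms by (auto simp: pderiv_diff pderiv_monom poly_monom power_0_left)
  moreover have "lead_coeff ?p = 1"
    unfolding deg using assms by (simp add: coeff_1)
  moreover have "{z. poly ?p z = 0} = {z. z ^ n = 1}"
    by (simp add: poly_monom)
  ultimately show ?thesis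
    using complex_poly_decompose_rsquarefree[of ?p] by simp
qed

lemma prod_cyclotomic_complex:
  assumes "n > 0"
  shows "(\<Prod>d | d dvd n. cyclotomic_complex d) = monom 1 n - 1"
proof -
  have pos: "d > 0" if "d dvd n" for d
    using that assms by (rule dvd_pos_nat[rotated])
  have "(\<Prod>z | z ^ n = 1. [:-z, 1:]) =
      (\<Prod>z\<in>(\<Union>d\<in>{d. d dvd n}. primitive_roots_unity d). [:-z, 1:] :: complex poly)"
    using roots_unity_decompose[OF assms] by simp
  also have "\<dots> = (\<Prod>d | d dvd n. cyclotomic_complex d)"
    unfolding cyclotomic_complex_def using assms pos
    by (intro prod.UNION_disjoint) (auto simp: finite_primitive_roots_unity
          dest: primitive_roots_unity_disjoint)
  finally show ?thesis
    using prod_roots_unity[OF assms] by simp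
qed

lemma lead_coeff_cyclotomic_complex: "lead_coeff (cyclotomic_complex n) = 1"
  by (simp add: cyclotomic_complex_def lead_coeff_prod)

lemma cyclotomic_complex_integral:
  assumes "n > 0"
  shows "\<exists>p :: int poly. map_poly of_int p = cyclotomic_complex n"
  using assms
proof (induction n rule: less_induct)
  case (less n)
  define D where "D = {d. d dvd n \<and> d \<noteq> n}"
  have D: "0 < d \<and> d < n" if "d \<in> D" for d
    using that less.prems by (auto simp: D_def dvd_pos_nat dest: dvd_imp_le intro: nat_dvd_not_less)
  have "\<forall>d\<in>D. \<exists>p :: int poly. map_poly of_int p = cyclotomic_complex d"
    using less.IH D by blast
  then obtain f :: "nat \<Rightarrow> int poly"
    where f: "\<And>d. d \<in> D \<Longrightarrow> map_poly of_int (f d) = cyclotomic_complex d"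
    by metis
  define F where "F = prod f D"
  define G where "G = map_poly (of_int :: int \<Rightarrow> complex) F"
  have G: "G = prod cyclotomic_complex D"
    by (simp add: G_def F_def map_poly_of_int_prod f)
  have lcG: "lead_coeff G = 1"
    by (simp add: G lead_coeff_prod lead_coeff_cyclotomic_complex)
  hence "of_int (lead_coeff F) = (1 :: complex)"
    by (simp add: G_def degree_map_poly_of_int coeff_map_poly)
  hence lcF: "lead_coeff F = 1" by simp
  hence F0: "F \<noteq> 0" by auto
  have "{d. d dvd n} = insert n D" "n \<notin> D" "finite D"
    using less.prems by (auto simp: D_def)
  hence main: "monom 1 n - 1 = G * cyclotomic_complex n"
    using prod_cyclotomic_complex[OF less.prems] by (simp add: G mult.commute)
  obtain q r where qr: "pseudo_divmod (monom 1 n - 1) F = (q, r)"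
    by (cases "pseudo_divmod (monom 1 n - 1) F")
  from pseudo_divmod[OF F0 qr] lcF
  have eq: "monom 1 n - 1 = F * q + r" and r: "r = 0 \<or> degree r < degree F" by simp_all
  have "map_poly of_int (monom 1 n - 1 :: int poly) = (monom 1 n - 1 :: complex poly)"
    by (intro poly_eqI) (simp add: coeff_map_poly coeff_1)
  hence "monom 1 n - 1 = G * map_poly of_int q + map_poly of_int r"
    unfolding eq by (simp add: G_def map_poly_of_int_add map_poly_of_int_mult)
  with main have r': "map_poly of_int r = G * (cyclotomic_complex n - map_poly of_int q)"
    by (simp add: algebra_simps)
  have "cyclotomic_complex n - map_poly of_int q = 0"
  proof (rule ccontr)
    assume *: "cyclotomic_complex n - map_poly of_int q \<noteq> 0"
    have "G \<noteq> 0" using lcG by auto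
    with * have "degree (map_poly (of_int :: int \<Rightarrow> complex) r) \<ge> degree G"
      unfolding r' by (simp add: degree_mult_eq)
    moreover have "r \<noteq> 0" using r' * \<open>G \<noteq> 0\<close> by auto
    ultimately show False
      using r by (simp add: degree_map_poly_of_int G_def)
  qed
  thus ?case by (intro exI[of _ q]) simp
qed

lemma of_int_cyclotomic:
  assumes "n > 0"
  shows "map_poly of_int (cyclotomic n) = cyclotomic_complex n"
proof -
  have "\<exists>!p :: int poly. map_poly of_int p = cyclotomic_complex n"
    using cyclotomic_complex_integral[OF assms] by (metis map_poly_of_int_inj)
  thus ?thesis unfolding cyclotomic_def by (rule theI')
qed

text \<open>
  \<open>\<int>[q, a]\<close> is represented as \<open>\<int>[q][a]\<close>: the inner variable of \<^typ>\<open>int poly poly\<close> is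
  \<open>q\<close>, the outer one is \<open>a\<close>.
\<close>

type_synonym qa_poly = "int poly poly"
type_synonym qa_ratfun = "qa_poly fract"

definition q_poly :: qa_poly where "q_poly = [:[:0, 1:]:]"
definition a_poly :: qa_poly where "a_poly = [:0, 1:]"

definition q_var :: qa_ratfun where "q_var = to_fract q_poly"
definition a_var :: qa_ratfun where "a_var = to_fract a_poly"

definition cyclotomic_q :: "nat \<Rightarrow> qa_poly" where "cyclotomic_q n = [:cyclotomic n:]"

text \<open>
  \<^const>\<open>quot_of_fract\<close> yields the reduced numerator and denominator of a fraction
  (coprime, with normalized denominator).
\<close>

definition ratfun_cong :: "qa_ratfun \<Rightarrow> qa_ratfun \<Rightarrow> qa_poly \<Rightarrow> bool" where
  "ratfun_cong A B P \<longleftrightarrow> P dvd fst (quot_of_fract (A - B))"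

definition qpoch :: "'a \<Rightarrow> 'a \<Rightarrow> nat \<Rightarrow> 'a :: comm_ring_1" where
  "qpoch x p k = (\<Prod>j<k. 1 - x * p ^ j)"

definition qpochs :: "'a list \<Rightarrow> 'a \<Rightarrow> nat \<Rightarrow> 'a :: comm_ring_1" where
  "qpochs xs p k = (\<Prod>x\<leftarrow>xs. qpoch x p k)"

definition qint :: "'a \<Rightarrow> nat \<Rightarrow> 'a :: comm_ring_1" where
  "qint q j = (\<Sum>i<j. q ^ i)"

end

(* The sum is essentially a value of T(q, a, b, x) = sum_k of a cubic very-well-poised term with
   a b = q, taken in base q^2 at x = q. It satisfies a first order recurrence linking x and x q^3,
   with an explicit telescoping certificate. Iterating it from x = 1 and from x = q^(-2) shows that T
   vanishes at x = q^(-N) for N congruent to 0 or 2 modulo 3, for every a. If q is a primitive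
   n-th root of unity, then q = (q^2)^(-(n-1)/2), and this settles the modulus Phi_n. For the modulus
   (1 - a q^n)(a - q^n) the sum terminates through a = q^(-M) with M congruent to 2 modulo 3; after clearing
   denominators it is a polynomial in x which vanishes at x = q^(-3m) for all large m, hence
   identically. The passage to reduced numerators only needs that the three factors of the modulus
   are pairwise coprime and coprime to an explicit common denominator. *)

theory Submission
  imports Defs
begin

section \<open>A cubic sum and its recurrence\<close>

text \<open>
  The rational function identity behind the telescoping, with \<open>y = q\<^sup>k\<close>. Both sides depend on \<open>a\<close> and
  \<open>b\<close> only through \<open>a b\<close> and \<open>s = a + b\<close>, and are linear in \<open>s\<close>.
\<close>

lemma certificate_identity:
  fixes a b q x y :: "'a::field"
  assumes ab: "a * b = q"
  shows "x * q * (1 - a*y) * (1 - b*y) * (1 - x*y^2) * (1 - x*q*y^2) * (1 - q*y^3) * (1 - x*y^3) * (1 - q^4*x^2*y^3)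
    - x * (1 - x*q^2*y) * ((1 - x*q^2*y^3*b) * (1 - x*a*q^2*y^3)) * (q - y^2) * (1 - y^2) * (1 - y) * (1 - q*x^2*y^3)
    = y * (1 - x*q*b) * (1 - x*q*a) * (1 - x*q^3*y^4) * (1 - x*y^3) * (1 - x*y^2) * (1 - x*q*y^2) * (1 - x*q^2*y^2)
      - (1 - q*x) * y * (1 - x*y^4) * (1 - x*y) * (1 - x*q*y) * (1 - x*q^2*y) * ((1 - x*q^2*y^3*b) * (1 - x*a*q^2*y^3))"
proof -
  define s where "s = a + b"
  have 1: "(1 - a*y) * (1 - b*y) = 1 - s*y + q*y^2"
    unfolding s_def ab[symmetric] by algebra
  have 2: "(1 - x*q^2*y^3*b) * (1 - x*a*q^2*y^3) = 1 - x*q^2*y^3*s + x^2*q^5*y^6"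
    unfolding s_def ab[symmetric] by algebra
  have 3: "(1 - x*q*b) * (1 - x*q*a) = 1 - x*q*s + x^2*q^3"
    unfolding s_def ab[symmetric] by algebra
  have "x * q * (1 - s*y + q*y^2) * (1 - x*y^2) * (1 - x*q*y^2) * (1 - q*y^3) * (1 - x*y^3) * (1 - q^4*x^2*y^3)
    - x * (1 - x*q^2*y) * (1 - x*q^2*y^3*s + x^2*q^5*y^6) * (q - y^2) * (1 - y^2) * (1 - y) * (1 - q*x^2*y^3)
    = y * (1 - x*q*s + x^2*q^3) * (1 - x*q^3*y^4) * (1 - x*y^3) * (1 - x*y^2) * (1 - x*q*y^2) * (1 - x*q^2*y^2)
      - (1 - q*x) * y * (1 - x*y^4) * (1 - x*y) * (1 - x*q*y) * (1 - x*q^2*y) * (1 - x*q^2*y^3*s + x^2*q^5*y^6)"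
    by algebra
  with 1 2 3 show ?thesis by (simp add: mult.assoc)
qed

section \<open>Rules for \<open>q\<close>-shifted factorials\<close>

lemma qpoch_0 [simp]: "qpoch x p 0 = 1"
  by (simp add: qpoch_def)

lemma qpoch_Suc: "qpoch x p (Suc k) = qpoch x p k * (1 - x * p ^ k)"
  by (simp add: qpoch_def)

lemma qpoch_add: "qpoch x p (m + n) = qpoch x p m * qpoch (x * p ^ m) p n"
  by (induction n) (simp_all add: qpoch_Suc power_add mult_ac)

lemma qpoch_Suc_left: "qpoch x p (Suc k) = (1 - x) * qpoch (x * p) p k"
  using qpoch_add[of x p 1 k] by (simp add: qpoch_Suc)

lemma qpoch_eq_0_iff:
  fixes x p :: "'a :: idom"
  shows "qpoch x p k = 0 \<longleftrightarrow> (\<exists>j<k. x * p ^ j = 1)"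
  by (auto simp: qpoch_def)

text \<open>
  With \<open>b = q / a\<close>, this is the summand multiplied by \<open>(x q\<^sup>3 / a, x a q\<^sup>2; q\<^sup>3)\<^bsub>K\<^esub>\<close>, so that it is
  polynomial in \<open>a\<close>, \<open>b\<close> and \<open>x\<close>; moreover \<open>(x; q)\<^bsub>2k\<^esub> / (x; q)\<^bsub>k\<^esub>\<close> is written as
  \<open>(x q\<^sup>k; q)\<^bsub>k\<^esub>\<close>, which keeps its meaning when \<open>x\<close> is a negative power of \<open>q\<close>.
\<close>

definition cubic_term :: "'a::field \<Rightarrow> 'a \<Rightarrow> 'a \<Rightarrow> 'a \<Rightarrow> nat \<Rightarrow> nat \<Rightarrow> 'a" where
  "cubic_term q a b x K k =
     (1 - x * q ^ (4 * k)) * (qpoch a q k * qpoch b q k) * qpoch (x * q ^ k) q k *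
     qpoch q (q ^ 3) k * qpoch x (q ^ 3) k * q ^ k *
     (qpoch (x * b * q ^ (2 + 3 * k)) (q ^ 3) (K - k) *
      qpoch (x * a * q ^ (2 + 3 * k)) (q ^ 3) (K - k)) /
     (qpoch q q (2 * k) * qpoch q q k)"

definition cubic_sum :: "'a::field \<Rightarrow> 'a \<Rightarrow> 'a \<Rightarrow> 'a \<Rightarrow> nat \<Rightarrow> 'a" where
  "cubic_sum q a b x K = (\<Sum>k\<le>K. cubic_term q a b x K k)"

lemma qpoch_shift:
  fixes x q :: "'a :: field"
  assumes "qpoch x q m \<noteq> 0"
  shows "qpoch (x * q ^ m) q n = qpoch x q (m + n) / qpoch x q m"
  using assms by (simp add: qpoch_add)

text \<open>Telescoping certificate, found by the \<open>q\<close>-Zeilberger algorithm for the shift \<open>x \<mapsto> x q\<^sup>3\<close>.\<close>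

definition cubic_certificate :: "'a::field \<Rightarrow> 'a \<Rightarrow> 'a \<Rightarrow> 'a \<Rightarrow> nat \<Rightarrow> nat \<Rightarrow> 'a" where
  "cubic_certificate q a b x K k = x * (q - (q^k)^2) * (1 - (q^k)^2) * (1 - q^k) * (1 - q * x^2 * (q^k)^3) *
     (qpoch a q k * qpoch b q k) * qpoch x q (2 * k) *
     qpoch q (q ^ 3) k * qpoch x (q ^ 3) k *
     (qpoch (x * b * q ^ (2 + 3 * k)) (q ^ 3) (K - k) *
      qpoch (x * a * q ^ (2 + 3 * k)) (q ^ 3) (K - k)) /
     (qpoch q q (2 * k) * qpoch q q k * qpoch x q (k + 2))"

text \<open>All four quantities are one common factor times a polynomial in \<open>q ^ k\<close>,
  which reduces the claim to \<open>certificate_identity\<close>. The sum at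
  \<open>x * q ^ 3\<close> is cleared with \<open>K - 1\<close> factors because its tails are then
  those at \<open>x\<close> without their first factor.\<close>

lemma cubic_telescope:
  fixes q a b x :: "'a::field"
  assumes ab: "a * b = q" and k: "k < K"
    and q: "\<And>j. 0 < j \<Longrightarrow> j \<le> 2 * K \<Longrightarrow> q ^ j \<noteq> 1"
    and x: "\<And>j. j \<le> K + 1 \<Longrightarrow> x * q ^ j \<noteq> 1"
  shows "(1 - x) * (1 - x*q*b) * (1 - x*q*a) * cubic_term q a b (x * q ^ 3) (K - 1) k
    - (1 - q*x) * cubic_term q a b x K k = cubic_certificate q a b x K (Suc k) - cubic_certificate q a b x K k"
proof -
  define y where "y = q ^ k"
  obtain m where m: "K = Suc (k + m)" using k less_iff_Suc_add by auto
  have q1: "qpoch q q i \<noteq> 0" if "i \<le> 2 * K" for i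
    using q[of "Suc j" for j] that by (auto simp: qpoch_eq_0_iff)
  have x1: "qpoch x q i \<noteq> 0" if "i \<le> K + 2" for i
    using x that by (auto simp: qpoch_eq_0_iff)
  \<comment> \<open>The denominator \<open>qpoch x q (k + 3)\<close> is the longest of those
    occurring in the two terms and the two certificates.\<close>
  define C where "C = (qpoch a q k * qpoch b q k) * qpoch x q (2 * k) *
     qpoch q (q ^ 3) k * qpoch x (q ^ 3) k *
     (qpoch (x * b * q ^ (5 + 3 * k)) (q ^ 3) m *
      qpoch (x * a * q ^ (5 + 3 * k)) (q ^ 3) m) /
     (qpoch q q (2 * k) * qpoch q q k * qpoch x q (k + 3))"
  define r where "r = (1 - x*q^2*y^3*b) * (1 - x*a*q^2*y^3)"
  have R: "qpoch (x * b * q ^ (2 + 3 * k)) (q ^ 3) (K - k) * qpoch (x * a * q ^ (2 + 3 * k)) (q ^ 3) (K - k) =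
    r * (qpoch (x * b * q ^ (5 + 3 * k)) (q ^ 3) m * qpoch (x * a * q ^ (5 + 3 * k)) (q ^ 3) m)"
  proof -
    have "qpoch (x * c * q ^ (2 + 3 * k)) (q ^ 3) (K - k) =
        (1 - x*q^2*y^3*c) * qpoch (x * c * q ^ (5 + 3 * k)) (q ^ 3) m" for c
    proof -
      have e: "K - k = Suc m" "x * c * q ^ (2 + 3 * k) * q ^ 3 = x * c * q ^ (5 + 3 * k)"
        "x * c * q ^ (2 + 3 * k) = x*q^2*y^3*c"
        using m by (simp_all add: y_def power_add mult_ac flip: power_mult)
          (simp_all add: eval_nat_numeral)
      show ?thesis unfolding e(1) qpoch_Suc_left e(2) unfolding e(3) ..
    qed
    thus ?thesis by (simp add: r_def mult_ac)
  qed
  have nzx: "1 - x*y \<noteq> 0" "1 - x*q*y \<noteq> 0" "1 - x*q^2*y \<noteq> 0"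
    using x[of k] x[of "k+1"] x[of "k+2"] k by (auto simp: y_def power_add power2_eq_square mult_ac)
  have nzq: "1 - q*y \<noteq> 0" "1 - q*y^2 \<noteq> 0" "1 - q^2*y^2 \<noteq> 0"
    using q[of "k+1"] q[of "2*k+1"] q[of "2*k+2"] k
    by (auto simp: y_def mult_ac simp flip: power_mult power_add)
  have xk3: "qpoch x q (k+3) = qpoch x q k * (1 - x*y) * (1 - x*q*y) * (1 - x*q^2*y)"
     "qpoch x q (k+2) = qpoch x q k * (1 - x*y) * (1 - x*q*y)"
    by (simp_all add: numeral_3_eq_3 numeral_2_eq_2 qpoch_Suc y_def mult_ac)
  have x1k: "qpoch x q k \<noteq> 0" using x1[of k] k by simp
  have y4: "q ^ (4 * k) = y ^ 4" by (simp add: y_def mult_ac flip: power_mult)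
  have y2: "q ^ (2 * k) = y ^ 2" by (simp add: y_def mult_ac flip: power_mult)
  have y3: "(q ^ 3) ^ k = y ^ 3" by (simp add: y_def mult_ac flip: power_mult)
  have U1: "cubic_term q a b x K k = C * y * (1 - x*y^4) * (1 - x*y) * (1 - x*q*y) * (1 - x*q^2*y) * r"
    unfolding cubic_term_def R C_def
    unfolding qpoch_shift[OF x1k] xk3 mult_2[symmetric] using x1k nzx y4
    by (simp add: y_def[symmetric] mult_ac)
  have x2k3: "qpoch x q (k+3+k) = qpoch x q (2*k) * (1 - x*y^2) * (1 - x*q*y^2) * (1 - x*q^2*y^2)"
  proof -
    have e: "k + 3 + k = Suc (Suc (Suc (2 * k)))" by simp
    show ?thesis unfolding e qpoch_Suc power_Suc y2 by (simp add: power2_eq_square mult_ac)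
  qed
  have U2: "(1 - x) * cubic_term q a b (x * q ^ 3) (K - 1) k
     = C * y * (1 - x*q^3*y^4) * (1 - x*y^3) * (1 - x*y^2) * (1 - x*q*y^2) * (1 - x*q^2*y^2)"
  proof -
    have 1: "qpoch (x * q ^ 3 * q ^ k) q k = qpoch x q (k+3+k) / qpoch x q (k+3)"
      using qpoch_shift[of x q "k+3" k] x1[of "k+3"] k by (simp add: power_add mult_ac)
    have 2: "(1 - x) * qpoch (x * q^3) (q^3) k = qpoch x (q^3) k * (1 - x * y^3)"
      by (metis qpoch_Suc qpoch_Suc_left y3)
    have 3: "K - 1 - k = m" "x * q^3 * b * q ^ (2 + 3 * k) = x * b * q ^ (5 + 3 * k)"
       "x * q^3 * a * q ^ (2 + 3 * k) = x * a * q ^ (5 + 3 * k)"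
      using m by (simp_all add: power_add eval_nat_numeral)
    have "(1 - x) * cubic_term q a b (x * q ^ 3) (K - 1) k =
      (1 - x * q^3 * q ^ (4 * k)) * (qpoch a q k * qpoch b q k) * (qpoch x q (k+3+k) / qpoch x q (k+3)) *
     qpoch q (q ^ 3) k * ((1 - x) * qpoch (x * q^3) (q^3) k) * q ^ k *
     (qpoch (x * b * q ^ (5 + 3 * k)) (q ^ 3) m *
      qpoch (x * a * q ^ (5 + 3 * k)) (q ^ 3) m) /
     (qpoch q q (2 * k) * qpoch q q k)"
      unfolding cubic_term_def 1 3 by simp
    also have "\<dots> = C * y * (1 - x*q^3*y^4) * (1 - x*y^3) * (1 - x*y^2) * (1 - x*q*y^2) * (1 - x*q^2*y^2)"
      unfolding 2 x2k3 C_def y4 y_def[symmetric] by (simp add: mult_ac)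
    finally show ?thesis .
  qed
  have G1: "cubic_certificate q a b x K k = C * (x * (1 - x*q^2*y) * r * (q - y^2) * (1 - y^2) * (1 - y) * (1 - q*x^2*y^3))"
    unfolding cubic_certificate_def R C_def xk3 y_def[symmetric]
    using x1[of k] k nzx by (simp add: mult_ac)
  have G2: "cubic_certificate q a b x K (Suc k) = C * (x * q * (1 - a*y) * (1 - b*y) * (1 - x*y^2) * (1 - x*q*y^2) * (1 - q*y^3) * (1 - x*y^3) * (1 - q^4*x^2*y^3))"
  proof -
    have e: "K - Suc k = m" "2 + 3 * Suc k = 5 + 3 * k" "Suc k + 2 = k + 3" "q ^ Suc k = q * y"
      "2 * Suc k = Suc (Suc (2 * k))"
      using m by (simp_all add: y_def)
    have p: "qpoch a q (Suc k) = qpoch a q k * (1 - a*y)" "qpoch b q (Suc k) = qpoch b q k * (1 - b*y)"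
      "qpoch x q (Suc (Suc (2*k))) = qpoch x q (2*k) * (1 - x*y^2) * (1 - x*q*y^2)"
      "qpoch q q (Suc (Suc (2*k))) = qpoch q q (2*k) * (1 - q*y^2) * (1 - q^2*y^2)"
      "qpoch q (q^3) (Suc k) = qpoch q (q^3) k * (1 - q*y^3)"
      "qpoch x (q^3) (Suc k) = qpoch x (q^3) k * (1 - x*y^3)"
      "qpoch q q (Suc k) = qpoch q q k * (1 - q*y)"
      unfolding qpoch_Suc power_Suc y_def[symmetric] y2 y3 by (simp_all add: power2_eq_square mult_ac)
    have f: "x * (q - (q*y)^2) * (1 - (q*y)^2) * (1 - q*y) * (1 - q * x^2 * (q*y)^3)
      = x * q * (1 - q*y^2) * (1 - q^2*y^2) * (1 - q*y) * (1 - q^4*x^2*y^3)"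
      by algebra
    show ?thesis
      unfolding cubic_certificate_def e f p C_def using nzq by (simp add: mult_ac)
  qed
  have "(1 - x) * (1 - x*q*b) * (1 - x*q*a) * cubic_term q a b (x * q ^ 3) (K - 1) k
    - (1 - q*x) * cubic_term q a b x K k =
    (1 - x*q*b) * (1 - x*q*a) * ((1 - x) * cubic_term q a b (x * q ^ 3) (K - 1) k)
    - (1 - q*x) * cubic_term q a b x K k"
    by simp
  also have "\<dots> = C * (y * (1 - x*q*b) * (1 - x*q*a) * (1 - x*q^3*y^4) * (1 - x*y^3) * (1 - x*y^2) * (1 - x*q*y^2) * (1 - x*q^2*y^2)
      - (1 - q*x) * y * (1 - x*y^4) * (1 - x*y) * (1 - x*q*y) * (1 - x*q^2*y) * r)"
    unfolding U1 U2 by (simp add: algebra_simps)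
  also have "\<dots> = cubic_certificate q a b x K (Suc k) - cubic_certificate q a b x K k"
    unfolding G1 G2 r_def certificate_identity[OF ab, symmetric] by (simp only: right_diff_distrib)
  finally show ?thesis .
qed

text \<open>Summing \<open>cubic_telescope\<close> over \<open>k < K\<close> leaves only the
  certificate at \<open>K\<close>, since it vanishes at \<open>0\<close>. Under each alternative of
  \<open>stop\<close> this boundary value equals \<open>(1 - q*x)\<close> times the
  \<open>K\<close>-th term, exactly what is missing from the sum at \<open>x\<close>.\<close>

lemma cubic_sum_step:
  fixes q a b x :: "'a::field"
  assumes ab: "a * b = q" and K: "K > 0"
    and q: "\<And>j. 0 < j \<Longrightarrow> j \<le> 2 * K \<Longrightarrow> q ^ j \<noteq> 1"
    and x: "\<And>j. j \<le> K + 1 \<Longrightarrow> x * q ^ j \<noteq> 1"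
    and stop: "x * q ^ (2 * K) = 1 \<or> x * q ^ (2 * K + 1) = 1 \<or> x * q ^ (3 * K) = 1"
  shows "(1 - q*x) * cubic_sum q a b x K =
    (1 - x) * (1 - x*q*b) * (1 - x*q*a) * cubic_sum q a b (x * q ^ 3) (K - 1)"
proof -
  define y where "y = q ^ K"
  have y: "q ^ (4 * K) = y ^ 4" "q ^ (3 * K) = y ^ 3" "q ^ (2 * K) = y ^ 2" "q ^ (2 * K + 1) = q * y ^ 2"
    by (simp_all add: y_def mult_ac flip: power_mult)
  have "y \<noteq> 0" using stop by (auto simp: y)
  have nz: "qpoch x q K \<noteq> 0" using x by (auto simp: qpoch_eq_0_iff)
  have nzx: "1 - x*y \<noteq> 0" "1 - x*q*y \<noteq> 0"
    using x[of K] x[of "K+1"] by (auto simp: y_def mult_ac)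
  have xk2: "qpoch x q (K+2) = qpoch x q K * (1 - x*y) * (1 - x*q*y)"
    by (simp_all add: numeral_2_eq_2 qpoch_Suc y_def mult_ac)
  have "y^4 * (x * (q - y^2) * (1 - y^2) * (1 - y) * (1 - q * x^2 * y^3)) =
    y^4 * ((1 - q*x) * y * (1 - x*y^4) * (1 - x*y) * (1 - x*q*y))"
    using stop unfolding y by (elim disjE) algebra+
  hence "x * (q - y^2) * (1 - y^2) * (1 - y) * (1 - q * x^2 * y^3) =
    (1 - q*x) * y * (1 - x*y^4) * (1 - x*y) * (1 - x*q*y)"
    using \<open>y \<noteq> 0\<close> by simp
  hence aux: "cubic_certificate q a b x K K = (1 - q*x) * cubic_term q a b x K K"
    unfolding cubic_certificate_def cubic_term_def qpoch_shift[OF nz] xk2 mult_2[symmetric]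
    unfolding y y_def[symmetric]
    using nz nzx by (simp add: mult_ac)
  have "(\<Sum>k<K. (1 - x) * (1 - x*q*b) * (1 - x*q*a) * cubic_term q a b (x * q ^ 3) (K - 1) k
      - (1 - q*x) * cubic_term q a b x K k) =
      (\<Sum>k<K. cubic_certificate q a b x K (Suc k) - cubic_certificate q a b x K k)"
    using cubic_telescope[OF ab _ q x] by (intro sum.cong) auto
  also have "\<dots> = (1 - q*x) * cubic_term q a b x K K"
    by (simp add: sum_lessThan_telescope aux) (simp add: cubic_certificate_def)
  finally have eq: "(1 - x) * (1 - x*q*b) * (1 - x*q*a) * (\<Sum>k<K. cubic_term q a b (x * q ^ 3) (K - 1) k) =
     (1 - q*x) * ((\<Sum>k<K. cubic_term q a b x K k) + cubic_term q a b x K K)"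
    unfolding sum_subtractf sum_distrib_left[symmetric] distrib_left by (simp only: diff_eq_eq add.commute)
  obtain K' where K': "K = Suc K'" using K by (cases K) auto
  show ?thesis using eq unfolding cubic_sum_def K' by (simp add: lessThan_Suc_atMost)
qed

section \<open>Vanishing of the sum at negative powers of \<open>q\<close>\<close>

lemma cubic_term_Suc:
  assumes "k \<le> K"
  shows "cubic_term q a b x (Suc K) k =
     (1 - x * b * q ^ (2 + 3 * K)) * (1 - x * a * q ^ (2 + 3 * K)) * cubic_term q a b x K k"
proof -
  have "qpoch (x * c * q ^ (2 + 3 * k)) (q ^ 3) (Suc K - k) =
     qpoch (x * c * q ^ (2 + 3 * k)) (q ^ 3) (K - k) * (1 - x * c * q ^ (2 + 3 * K))" for c
  proof -
    have "2 + 3 * k + 3 * (K - k) = 2 + 3 * K" using assms by simp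
    hence "q ^ (2 + 3 * k) * (q ^ 3) ^ (K - k) = q ^ (2 + 3 * K)"
      unfolding power_mult[symmetric] power_add[symmetric] by simp
    thus ?thesis using assms by (simp add: Suc_diff_le qpoch_Suc mult.assoc)
  qed
  thus ?thesis unfolding cubic_term_def by (simp add: mult_ac)
qed

text \<open>Passing to \<open>Suc K\<close> enlarges the common denominator by two factors
  independent of \<open>k\<close>, so sums of different lengths can be compared.\<close>

lemma cubic_sum_Suc:
  "cubic_sum q a b x (Suc K) =
     (1 - x * b * q ^ (2 + 3 * K)) * (1 - x * a * q ^ (2 + 3 * K)) * cubic_sum q a b x K +
     cubic_term q a b x (Suc K) (Suc K)"
  unfolding cubic_sum_def by (simp add: cubic_term_Suc sum_distrib_left)

lemma cubic_sum_eq_0_extend: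
  assumes "cubic_sum q a b x K = 0" and "K \<le> K'"
    and "\<And>k. K < k \<Longrightarrow> k \<le> K' \<Longrightarrow> cubic_term q a b x k k = 0"
  shows "cubic_sum q a b x K' = 0"
  using assms(2,3)
proof (induction rule: dec_induct)
  case base thus ?case using assms(1) by simp
next
  case (step n) thus ?case by (simp add: cubic_sum_Suc)
qed

lemma power_neg_ne_1:
  fixes q x :: "'a::field"
  assumes "x * q ^ N = 1" and "\<And>j. 0 < j \<Longrightarrow> j \<le> N \<Longrightarrow> q ^ j \<noteq> 1" and "j < N"
  shows "x * q ^ j \<noteq> 1"
proof
  assume "x * q ^ j = 1"
  moreover have "x * q ^ N = x * q ^ j * q ^ (N - j)"
    using assms(3) by (simp add: mult.assoc flip: power_add)
  ultimately show False using assms by simp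
qed

text \<open>Here \<open>x\<close> is \<open>q^(-3m)\<close>. Each step of the recurrence uses the
  third stopping alternative and lowers \<open>m\<close> by one, down to \<open>x = 1\<close>, where
  the only term is \<open>1 - x\<close>.\<close>

lemma cubic_sum_eq_0_mod0:
  fixes q a b x :: "'a::field"
  assumes "a * b = q" and "x * q ^ (3 * m) = 1"
    and "\<And>j. 0 < j \<Longrightarrow> j \<le> 3 * m \<Longrightarrow> q ^ j \<noteq> 1"
  shows "cubic_sum q a b x m = 0"
  using assms(2,3)
proof (induction m arbitrary: x)
  case 0
  then show ?case by (simp add: cubic_sum_def cubic_term_def)
next
  case (Suc m)
  have x: "x * q ^ j \<noteq> 1" if "j \<le> Suc m + 1" for j
    using that Suc.prems by (intro power_neg_ne_1[of x q "3 * Suc m"]) auto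
  have "x * q ^ 3 * q ^ (3 * m) = 1"
    using Suc.prems(1) by (simp add: power_add mult_ac)
  hence "cubic_sum q a b (x * q ^ 3) m = 0"
    using Suc.prems by (intro Suc.IH) auto
  hence "(1 - q*x) * cubic_sum q a b x (Suc m) = 0"
    using cubic_sum_step[of a b q "Suc m" x] x Suc.prems assms(1) by simp
  thus ?case using x[of 1] by (simp add: mult_ac)
qed

text \<open>Put \<open>N = 3 * m + 2\<close>. A whole range of \<open>K\<close> is treated so that
  the induction closes: the step from \<open>N div 2\<close> lands at \<open>N div 2 - 1\<close>,
  which exceeds \<open>(N - 3) div 2\<close> when \<open>N\<close> is even.\<close>

lemma cubic_sum_eq_0_mod2:
  fixes q a b x :: "'a::field"
  assumes "a * b = q" and "x * q ^ (3 * m + 2) = 1"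
    and "\<And>j. 0 < j \<Longrightarrow> j \<le> 3 * m + 2 \<Longrightarrow> q ^ j \<noteq> 1"
    and "K \<le> 3 * m + 2" and "3 * m + 2 \<le> 2 * K + 1"
  shows "cubic_sum q a b x K = 0"
  using assms(2-)
proof (induction m arbitrary: x K)
  case 0
  \<comment> \<open>The base case is computed directly, as the recurrence for \<open>K = 1\<close>
    would require \<open>x * q ^ 2 \<noteq> 1\<close>.\<close>
  have nz: "1 - q \<noteq> 0" "1 - q * q \<noteq> 0" using "0.prems"(2)[of 1] "0.prems"(2)[of 2] by (auto simp: power2_eq_square)
  have x: "x * q^2 = 1" using 0 by (simp add: power2_eq_square)
  hence "q \<noteq> 0" by auto
  have 1: "cubic_sum q a b x 1 = 0"
  proof -
    have "cubic_sum q a b x 1 = (1 - x) * (1 - x*b*q^2) * (1 - x*a*q^2) +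
      (1 - x*q^4) * ((1 - a) * (1 - b)) * (1 - x * q) * (1 - q) * (1 - x) * q / ((1 - q) * (1 - q * q) * (1 - q))"
      by (simp add: cubic_sum_def cubic_term_def qpoch_def numeral_2_eq_2)
    also have "\<dots> = (1 - x) * (1 - b) * (1 - a) +
      (1 - q * q) * ((1 - a) * (1 - b)) * (q - 1) * (1 - q) * (1 - x) / ((1 - q) * (1 - q * q) * (1 - q))"
    proof -
      have e: "x*b*q^2 = b" "x*a*q^2 = a" "x*q^4 = q*q" using x by algebra+
      have "(1 - q*q) * ((1 - a) * (1 - b)) * (1 - x * q) * (1 - q) * (1 - x) * q =
        (1 - q * q) * ((1 - a) * (1 - b)) * (q - 1) * (1 - q) * (1 - x)" using x by algebra
      thus ?thesis unfolding e by (simp only:)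
    qed
    also have "\<dots> = 0"
    proof -
      have "(1 - q * q) * ((1 - a) * (1 - b)) * (q - 1) * (1 - q) * (1 - x) =
        - ((1 - a) * (1 - b) * (1 - x)) * ((1 - q) * (1 - q * q) * (1 - q))" by algebra
      hence "(1 - q * q) * ((1 - a) * (1 - b)) * (q - 1) * (1 - q) * (1 - x) / ((1 - q) * (1 - q * q) * (1 - q))
        = - ((1 - a) * (1 - b) * (1 - x))"
        using nz by (simp add: nonzero_divide_eq_eq)
      thus ?thesis by simp
    qed
    finally show ?thesis .
  qed
  have "cubic_term q a b x 2 2 = 0"
    using x by (simp add: cubic_term_def qpoch_def numeral_2_eq_2)
  with 1 have "cubic_sum q a b x 2 = 0"
    using cubic_sum_Suc[of q a b x 1] by (simp add: numeral_2_eq_2)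
  moreover have "K = 1 \<or> K = 2" using 0 by auto
  ultimately show ?case using 1 by auto
next
  case (Suc m)
  define N where "N = 3 * m + 5"
  define K0 where "K0 = N div 2"
  have xN: "x * q ^ N = 1" and qN: "\<And>j. 0 < j \<Longrightarrow> j \<le> N \<Longrightarrow> q ^ j \<noteq> 1"
    using Suc.prems by (auto simp: N_def add.commute)
  have K0: "K0 > 0" "2 * K0 = N \<or> 2 * K0 + 1 = N" "K0 + 1 < N" by (auto simp: K0_def N_def)
  have x: "x * q ^ j \<noteq> 1" if "j < N" for j
    using that xN qN by (intro power_neg_ne_1[of x q N]) auto
  have "N = 3 + (3 * m + 2)" by (simp add: N_def)
  hence "x * q ^ 3 * q ^ (3 * m + 2) = 1"
    using xN by (simp only: power_add mult.assoc)
  hence "cubic_sum q a b (x * q ^ 3) (K0 - 1) = 0"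
    using Suc.prems K0 by (intro Suc.IH) (auto simp: N_def)
  hence "(1 - q*x) * cubic_sum q a b x K0 = 0"
    using cubic_sum_step[of a b q K0 x] x qN K0 xN assms(1) by auto
  hence "cubic_sum q a b x K0 = 0" using x[of 1] K0 by (simp add: mult_ac)
  thus ?case
  proof (rule cubic_sum_eq_0_extend)
    show "K0 \<le> K" using Suc.prems K0 by (auto simp: N_def)
    fix k assume k: "K0 < k" "k \<le> K"
    hence kN: "k \<le> N" "N - k < k" using Suc.prems K0 by (auto simp: N_def)
    \<comment> \<open>For \<open>k \<le> N < 2 * k\<close> the product
      \<open>qpoch (x * q ^ k) q k\<close> contains the factor \<open>1 - x * q ^ N\<close>.\<close>
    have "x * q ^ k * q ^ (N - k) = 1" using xN kN by (simp add: mult.assoc flip: power_add)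
    hence "qpoch (x * q ^ k) q k = 0" using kN by (auto simp: qpoch_eq_0_iff)
    thus "cubic_term q a b x k k = 0" by (simp add: cubic_term_def)
  qed
qed

section \<open>Sums terminating through \<open>a\<close>\<close>

lemma poly_qpoch: "poly (qpoch P [:p:] k) x = qpoch (poly P x) p k"
  by (simp add: qpoch_def poly_prod)

text \<open>The clearing of denominators pays off here: \<open>x\<close> enters only through
  polynomial factors, so infinitely many zeros in \<open>x\<close> force the sum to vanish.\<close>

lemma cubic_sum_polynomial: "\<exists>P. \<forall>x. poly P x = cubic_sum q a b x K"
proof -
  define c where "c k = (qpoch a q k * qpoch b q k) * qpoch q (q ^ 3) k * q ^ k / (qpoch q q (2 * k) * qpoch q q k)" for k
  define P where "P = (\<Sum>k\<le>K. smult (c k) ((1 - [:0, q ^ (4 * k):]) * qpoch [:0, q ^ k:] [:q:] k * qpoch [:0, 1:] [:q ^ 3:] k *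
     qpoch [:0, b * q ^ (2 + 3 * k):] [:q ^ 3:] (K - k) * qpoch [:0, a * q ^ (2 + 3 * k):] [:q ^ 3:] (K - k)))"
  have "poly P x = cubic_sum q a b x K" for x
    unfolding P_def cubic_sum_def cubic_term_def c_def poly_sum
    by (intro sum.cong) (simp_all add: poly_qpoch mult_ac)
  thus ?thesis by blast
qed

lemma power_inj_of_not_root_of_unity:
  fixes q :: "'a::field"
  assumes "q \<noteq> 0" and "\<And>j. j > 0 \<Longrightarrow> q ^ j \<noteq> 1"
  shows "inj (\<lambda>i::nat. q ^ i)"
proof (rule linorder_injI)
  fix i j :: nat assume "i < j"
  hence "q ^ j = q ^ i * q ^ (j - i)" by (simp flip: power_add)
  thus "q ^ i \<noteq> q ^ j" using assms \<open>i < j\<close> by auto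
qed

text \<open>Zeros in \<open>x\<close> are supplied by the points \<open>q^(-3m)\<close> with
  \<open>m > M\<close>, where \<open>cubic_sum_eq_0_mod0\<close> applies to the sum up to
  \<open>m\<close>. They are distinct because \<open>q\<close> is not a root of unity.\<close>

lemma cubic_sum_terminating_eq_0:
  fixes q a b x :: "'a::field"
  assumes ab: "a * b = q" and a: "a * q ^ M = 1" and M: "M mod 3 = 2"
    and q: "\<And>j. j > 0 \<Longrightarrow> q ^ j \<noteq> 1"
  shows "cubic_sum q a b x M = 0"
proof -
  have "q \<noteq> 0" using a M by (auto simp: power_0_left split: if_splits)
  have inj: "q ^ i = q ^ j \<longleftrightarrow> i = j" for i j
    using power_inj_of_not_root_of_unity[OF \<open>q \<noteq> 0\<close> q] by (auto simp: inj_def)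
  have a': "a = 1 / q ^ M" using a \<open>q \<noteq> 0\<close> by (simp add: field_simps)
  have b': "b = q ^ Suc M"
  proof -
    have "(a * b) * q ^ M = (a * q ^ M) * b" by (simp only: mult_ac)
    thus ?thesis by (simp add: a ab)
  qed
  \<comment> \<open>For \<open>M < m\<close> the sum up to \<open>m\<close> stops at \<open>M\<close> since \<open>(a; q)\<^bsub>k\<^esub> = 0\<close> for \<open>k > M\<close>, and the superfluous
    factors of the common denominator do not vanish because \<open>M\<close> is \<open>2\<close> modulo \<open>3\<close>.\<close>
  have zero: "cubic_sum q a b (1 / q ^ (3 * m)) M = 0" if "M < m" for m
  proof (rule ccontr)
    define x where "x = 1 / q ^ (3 * m)"
    have x: "x * q ^ (3 * m) = 1" using \<open>q \<noteq> 0\<close> by (simp add: x_def)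
    assume nz: "cubic_sum q a b (1 / q ^ (3 * m)) M \<noteq> 0"
    have "n \<le> m \<Longrightarrow> cubic_sum q a b x n \<noteq> 0" if "M \<le> n" for n
      using that
    proof (induction rule: dec_induct)
      case base thus ?case using nz by (simp add: x_def)
    next
      case (step n)
      have "1 - x * b * q ^ (2 + 3 * n) \<noteq> 0"
      proof
        assume "1 - x * b * q ^ (2 + 3 * n) = 0"
        hence "q ^ (3 * m) = q ^ (Suc M + (2 + 3 * n))"
          using \<open>q \<noteq> 0\<close> unfolding x_def b' power_add by (simp add: field_simps)
        hence "3 * m = Suc M + (2 + 3 * n)" by (simp only: inj)
        thus False using M by presburger
      qed
      \<comment> \<open>For this factor the residue of \<open>M\<close> alone gives no
        contradiction; the equation forces \<open>n \<ge> m\<close>, against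
        \<open>n < m\<close>.\<close>
      moreover have "1 - x * a * q ^ (2 + 3 * n) \<noteq> 0"
      proof
        assume "1 - x * a * q ^ (2 + 3 * n) = 0"
        hence "q ^ (3 * m + M) = q ^ (2 + 3 * n)"
          using \<open>q \<noteq> 0\<close> unfolding x_def a' power_add by (simp add: field_simps)
        hence "3 * m + M = 2 + 3 * n" by (simp only: inj)
        thus False using M step.prems by presburger
      qed
      moreover have "qpoch a q (Suc n) = 0"
        using a step.hyps by (auto simp: qpoch_eq_0_iff intro!: exI[of _ M])
      hence "cubic_term q a b x (Suc n) (Suc n) = 0" by (simp add: cubic_term_def)
      ultimately show ?case using step by (simp add: cubic_sum_Suc)
    qed
    moreover have "cubic_sum q a b x m = 0"
      using cubic_sum_eq_0_mod0[OF ab x] q by simp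
    ultimately show False using that by simp
  qed
  obtain P where P: "\<And>x. poly P x = cubic_sum q a b x M"
    using cubic_sum_polynomial by metis
  have "inj_on (\<lambda>m. 1 / q ^ (3 * m)) {M<..}"
    using inj[of "3 * i" "3 * j" for i j] by (auto simp: inj_on_def)
  hence "infinite ((\<lambda>m. 1 / q ^ (3 * m)) ` {M<..})"
    by (simp add: finite_image_iff infinite_Ioi)
  moreover have "(\<lambda>m. 1 / q ^ (3 * m)) ` {M<..} \<subseteq> {x. poly P x = 0}"
    using zero by (auto simp: P)
  ultimately have "infinite {x. poly P x = 0}" by (metis finite_subset)
  hence "P = 0" using poly_roots_finite by blast
  thus ?thesis using P by (metis poly_0)
qed

section \<open>Common denominators\<close>

text \<open>A division-free form of \<open>(a x; p)_k (x / a; p)_k\<close>, scaled by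
  \<open>a ^ k\<close>, so that it makes sense in the polynomial ring.\<close>

definition sym_poch :: "'a::comm_ring_1 \<Rightarrow> 'a \<Rightarrow> 'a \<Rightarrow> nat \<Rightarrow> 'a" where
  "sym_poch a x p k = (\<Prod>j<k. (1 - a * (x * p ^ j)) * (a - x * p ^ j))"

lemma sym_poch_add: "sym_poch a x p (m + n) = sym_poch a x p m * sym_poch a (x * p ^ m) p n"
  by (induction n) (simp_all add: sym_poch_def power_add mult_ac)

lemma sym_poch_eq:
  fixes a :: "'a::field"
  assumes "a \<noteq> 0"
  shows "sym_poch a x p k = a ^ k * (qpoch (a * x) p k * qpoch (x / a) p k)"
proof -
  have "sym_poch a x p k = (\<Prod>j<k. a * ((1 - a * x * p ^ j) * (1 - x / a * p ^ j)))"
    unfolding sym_poch_def using assms by (intro prod.cong) (auto simp: field_simps)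
  thus ?thesis by (simp add: prod.distrib qpoch_def)
qed

text \<open>
  Numerator of the \<open>k\<close>-th summand and denominator when the first \<open>K + 1\<close> summands are brought to a common
  denominator; the powers of \<open>a\<close> coming from \<open>q / a\<close> and \<open>q\<^sup>6 / a\<close> cancel.
\<close>

definition common_num :: "'a::comm_ring_1 \<Rightarrow> 'a \<Rightarrow> nat \<Rightarrow> nat \<Rightarrow> 'a" where
  "common_num q a K k = qint q (8 * k + 1) * sym_poch a q (q ^ 2) k * qpoch q (q ^ 2) (2 * k) *
     (qpoch q (q ^ 6) k * qpoch (q ^ 2) (q ^ 6) k) * q ^ (2 * k) *
     sym_poch a (q ^ 6 * (q ^ 6) ^ k) (q ^ 6) (K - k) *
     qpoch (q ^ 2 * (q ^ 2) ^ (2 * k)) (q ^ 2) (2 * (K - k)) * qpoch (q * q ^ (2 * k)) q (2 * (K - k))"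

definition common_den :: "'a::comm_ring_1 \<Rightarrow> 'a \<Rightarrow> nat \<Rightarrow> 'a" where
  "common_den q a K = sym_poch a (q ^ 6) (q ^ 6) K * qpoch (q ^ 2) (q ^ 2) (2 * K) * qpoch q q (2 * K)"

lemma common_den_split:
  assumes "k \<le> K"
  shows "sym_poch a (q ^ 6) (q ^ 6) K = sym_poch a (q ^ 6) (q ^ 6) k * sym_poch a (q ^ 6 * (q ^ 6) ^ k) (q ^ 6) (K - k)"
    "qpoch (q ^ 2) (q ^ 2) (2 * K) = qpoch (q ^ 2) (q ^ 2) (2 * k) * qpoch (q ^ 2 * (q ^ 2) ^ (2 * k)) (q ^ 2) (2 * (K - k))"
    "qpoch q q (2 * K) = qpoch q q (2 * k) * qpoch (q * q ^ (2 * k)) q (2 * (K - k))"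
proof -
  have e: "K = k + (K - k)" "2 * K = 2 * k + 2 * (K - k)" using assms by auto
  show "sym_poch a (q ^ 6) (q ^ 6) K = sym_poch a (q ^ 6) (q ^ 6) k * sym_poch a (q ^ 6 * (q ^ 6) ^ k) (q ^ 6) (K - k)"
    by (subst e(1)) (rule sym_poch_add)
  show "qpoch (q ^ 2) (q ^ 2) (2 * K) = qpoch (q ^ 2) (q ^ 2) (2 * k) * qpoch (q ^ 2 * (q ^ 2) ^ (2 * k)) (q ^ 2) (2 * (K - k))"
    by (subst e(2)) (rule qpoch_add)
  show "qpoch q q (2 * K) = qpoch q q (2 * k) * qpoch (q * q ^ (2 * k)) q (2 * (K - k))"
    by (subst e(2)) (rule qpoch_add)
qed

lemma summand_common_den:
  fixes q a :: "'a::field"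
  assumes a: "a \<noteq> 0" and den: "common_den q a K \<noteq> 0" and k: "k \<le> K"
  shows "qint q (8 * k + 1) *
      (qpochs [a * q, q / a] (q ^ 2) k * qpoch q (q ^ 2) (2 * k) * qpochs [q, q ^ 2] (q ^ 6) k /
       (qpoch (q ^ 2) (q ^ 2) (2 * k) * qpochs [a * q ^ 6, q ^ 6 / a] (q ^ 6) k *
        qpoch q q (2 * k))) * q ^ (2 * k) = common_num q a K k / common_den q a K"
proof -
  note split = common_den_split[OF k]
  from den have nz: "sym_poch a (q ^ 6) (q ^ 6) k \<noteq> 0" "sym_poch a (q ^ 6 * (q ^ 6) ^ k) (q ^ 6) (K - k) \<noteq> 0"
    "qpoch (q ^ 2) (q ^ 2) (2 * k) \<noteq> 0" "qpoch (q ^ 2 * (q ^ 2) ^ (2 * k)) (q ^ 2) (2 * (K - k)) \<noteq> 0"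
    "qpoch q q (2 * k) \<noteq> 0" "qpoch (q * q ^ (2 * k)) q (2 * (K - k)) \<noteq> 0"
    unfolding common_den_def split by auto
  have "qpochs [a * q, q / a] (q ^ 2) k = sym_poch a q (q ^ 2) k / a ^ k"
    "qpochs [a * q ^ 6, q ^ 6 / a] (q ^ 6) k = sym_poch a (q ^ 6) (q ^ 6) k / a ^ k"
    using a by (simp_all add: qpochs_def sym_poch_eq)
  moreover have "qpochs [q, q ^ 2] (q ^ 6) k = qpoch q (q ^ 6) k * qpoch (q ^ 2) (q ^ 6) k"
    by (simp add: qpochs_def)
  ultimately show ?thesis
    unfolding common_num_def common_den_def split using nz a by (simp add: mult_ac)
qed

section \<open>Identification with the cubic sum in base \<open>q ^ 2\<close>\<close>

lemma qint_geometric: "(1 - q) * qint q m = 1 - q ^ m"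
  unfolding qint_def by (simp add: one_diff_power_eq)

lemma qpoch_double: "qpoch q q (2 * k) = qpoch q (q ^ 2) k * qpoch (q ^ 2) (q ^ 2) k"
  by (induction k) (simp_all add: qpoch_Suc power2_eq_square power_mult power_mult_distrib mult_ac)

text \<open>By \<open>qpoch_double\<close>, the quotient of \<open>qpoch q (q ^ 2) (2 * k)\<close>
  by \<open>qpoch q q (2 * k)\<close> becomes that of
  \<open>qpoch (q * q ^ (2 * k)) (q ^ 2) k\<close> by \<open>qpoch (q ^ 2) (q ^ 2) k\<close>. Only
  denominators free of \<open>a\<close> have to be nonzero, so \<open>a\<close> may be specialized
  to a pole of a summand.\<close>

lemma common_num_cubic_term:
  fixes q a :: "'a::field"
  assumes a: "a \<noteq> 0" and k: "k \<le> K"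
    and nz1: "qpoch (q ^ 2) (q ^ 2) (2 * K) \<noteq> 0" and nz2: "qpoch q q (2 * K) \<noteq> 0"
  shows "(1 - q) * common_num q a K k =
    a ^ K * qpoch (q ^ 2) (q ^ 2) (2 * K) * qpoch q q (2 * K) * cubic_term (q ^ 2) (a * q) (q / a) q K k"
proof -
  note split = common_den_split[OF k]
  from nz1 nz2 have nz:
    "qpoch (q ^ 2) (q ^ 2) (2 * k) \<noteq> 0" "qpoch q (q ^ 2) k \<noteq> 0" "qpoch (q ^ 2) (q ^ 2) k \<noteq> 0"
    unfolding split qpoch_double[of q k] by auto
  have e1: "a ^ K = a ^ k * a ^ (K - k)" using k by (simp flip: power_add)
  have e2: "(q ^ 2) ^ (4 * k) = q ^ (8 * k)" "(q ^ 2) ^ k = q ^ (2 * k)" "(q ^ 2) ^ 3 = q ^ 6"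
    by (simp_all flip: power_mult)
  have e3: "q * (q / a) * (q ^ 2) ^ (2 + 3 * k) = q ^ 6 * (q ^ 6) ^ k / a"
    "q * (a * q) * (q ^ 2) ^ (2 + 3 * k) = a * (q ^ 6 * (q ^ 6) ^ k)"
  proof -
    have "q * q * (q ^ 2) ^ (2 + 3 * k) = q ^ 6 * (q ^ 6) ^ k"
      by (simp add: power_add mult_ac flip: power_mult) (simp add: eval_nat_numeral)
    thus "q * (q / a) * (q ^ 2) ^ (2 + 3 * k) = q ^ 6 * (q ^ 6) ^ k / a"
      "q * (a * q) * (q ^ 2) ^ (2 + 3 * k) = a * (q ^ 6 * (q ^ 6) ^ k)"
      by (simp_all add: mult_ac)
  qed
  have e4: "(1 - q) * common_num q a K k = (1 - q * q ^ (8 * k)) * sym_poch a q (q ^ 2) k * qpoch q (q ^ 2) (2 * k) *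
     (qpoch q (q ^ 6) k * qpoch (q ^ 2) (q ^ 6) k) * q ^ (2 * k) *
     sym_poch a (q ^ 6 * (q ^ 6) ^ k) (q ^ 6) (K - k) *
     qpoch (q ^ 2 * (q ^ 2) ^ (2 * k)) (q ^ 2) (2 * (K - k)) * qpoch (q * q ^ (2 * k)) q (2 * (K - k))"
    using qint_geometric[of q "8 * k + 1"] unfolding common_num_def by (simp add: mult.assoc[symmetric])
  have e5: "qpoch q (q ^ 2) (2 * k) = qpoch q (q ^ 2) k * qpoch (q * q ^ (2 * k)) (q ^ 2) k"
    using qpoch_add[of q "q^2" k k] by (simp add: mult_2 flip: power_mult)
  show ?thesis
    unfolding e4 sym_poch_eq[OF a] split e1 e5 cubic_term_def e3 unfolding e2 qpoch_double[of q k]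
    using nz by (simp add: mult_ac)
qed

lemma sum_common_num:
  fixes q a :: "'a::field"
  assumes "a \<noteq> 0" and "qpoch (q ^ 2) (q ^ 2) (2 * K) \<noteq> 0" and "qpoch q q (2 * K) \<noteq> 0"
    and "cubic_sum (q ^ 2) (a * q) (q / a) q K = 0" and "q \<noteq> 1"
  shows "(\<Sum>k\<le>K. common_num q a K k) = 0"
proof -
  have "(1 - q) * (\<Sum>k\<le>K. common_num q a K k) = (\<Sum>k\<le>K. (1 - q) * common_num q a K k)"
    by (simp add: sum_distrib_left)
  also have "\<dots> = (\<Sum>k\<le>K. a ^ K * qpoch (q ^ 2) (q ^ 2) (2 * K) * qpoch q q (2 * K) * cubic_term (q ^ 2) (a * q) (q / a) q K k)"
    using assms by (intro sum.cong refl common_num_cubic_term) auto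
  also have "\<dots> = 0"
    using assms(4) by (simp add: cubic_sum_def flip: sum_distrib_left)
  finally show ?thesis using assms(5) by simp
qed

lemma cubic_sum_commute: "cubic_sum q a b x K = cubic_sum q b a x K"
  unfolding cubic_sum_def cubic_term_def by (simp add: mult_ac)

text \<open>Since \<open>n = 2 * N + 1\<close> is odd, \<open>\<zeta> ^ 2\<close> again has order
  \<open>n\<close>, and \<open>\<zeta>\<close> is its power with exponent \<open>- N\<close>. The
  residue \<open>N mod 3 = 1\<close> would mean that \<open>3\<close> divides
  \<open>n\<close>.\<close>

lemma sum_common_num_root_of_unity:
  fixes \<zeta> a :: "'a::field"
  assumes n: "n > 1" "coprime n 6" and \<zeta>: "\<zeta> ^ n = 1" "\<And>m. 0 < m \<Longrightarrow> m < n \<Longrightarrow> \<zeta> ^ m \<noteq> 1"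
    and a: "a \<noteq> 0"
  shows "(\<Sum>k\<le>(n - 1) div 2. common_num \<zeta> a ((n - 1) div 2) k) = 0"
proof -
  define N where "N = (n - 1) div 2"
  have "odd n" "\<not> 3 dvd n"
    using n by (auto dest: coprime_common_divisor[of n 6 2] coprime_common_divisor[of n 6 3])
  hence nN: "n = 2 * N + 1" by (auto simp: N_def elim: oddE)
  have ord: "n dvd m" if "\<zeta> ^ m = 1" for m
  proof (rule ccontr)
    assume "\<not> n dvd m"
    hence "0 < m mod n" "m mod n < n" using n by (auto simp: dvd_eq_mod_eq_0)
    moreover have "\<zeta> ^ m = (\<zeta> ^ n) ^ (m div n) * \<zeta> ^ (m mod n)" by (simp flip: power_mult power_add)
    ultimately show False using \<zeta> that by simp
  qed
  have ord2: "(\<zeta> ^ 2) ^ j \<noteq> 1" if "0 < j" "j < n" for j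
  proof
    assume "(\<zeta> ^ 2) ^ j = 1"
    hence "n dvd 2 * j" using ord by (simp flip: power_mult)
    hence "n dvd j" using \<open>odd n\<close> by (simp add: coprime_dvd_mult_right_iff)
    thus False using that by (auto dest: dvd_imp_le)
  qed
  have "\<zeta> \<noteq> 0" using \<zeta>(1) n by (auto simp: power_0_left)
  have ab: "a * \<zeta> * (\<zeta> / a) = \<zeta> ^ 2" using a by (simp add: power2_eq_square)
  have x: "\<zeta> * (\<zeta> ^ 2) ^ N = 1" using \<zeta>(1) unfolding nN by (simp flip: power_mult)
  have "cubic_sum (\<zeta> ^ 2) (a * \<zeta>) (\<zeta> / a) \<zeta> N = 0"
  proof -
    have "N mod 3 = 0 \<or> N mod 3 = 2" using \<open>\<not> 3 dvd n\<close> unfolding nN by presburger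
    thus ?thesis
    proof
      assume "N mod 3 = 0"
      then obtain m where m: "N = 3 * m" by auto
      \<comment> \<open>The sum up to \<open>m = N div 3\<close> vanishes by the recurrence; all
        later terms contain the zero factor
        \<open>1 - \<zeta> * (\<zeta> ^ 2) ^ (3 * m)\<close>.\<close>
      have "cubic_sum (\<zeta> ^ 2) (a * \<zeta>) (\<zeta> / a) \<zeta> m = 0"
        using x ord2 ab by (intro cubic_sum_eq_0_mod0) (auto simp: m nN)
      thus ?thesis
      proof (rule cubic_sum_eq_0_extend)
        fix k assume "m < k"
        moreover have "\<zeta> * ((\<zeta> ^ 2) ^ 3) ^ m = 1" using x unfolding m by (simp flip: power_mult)
        ultimately have "qpoch \<zeta> ((\<zeta> ^ 2) ^ 3) k = 0" by (auto simp: qpoch_eq_0_iff)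
        thus "cubic_term (\<zeta> ^ 2) (a * \<zeta>) (\<zeta> / a) \<zeta> k k = 0" by (simp add: cubic_term_def)
      qed (simp add: m)
    next
      assume "N mod 3 = 2"
      then obtain m where m: "N = 3 * m + 2" by (metis mult_div_mod_eq)
      show ?thesis
        using x ord2 ab by (intro cubic_sum_eq_0_mod2[of _ _ _ _ m]) (auto simp: m nN)
    qed
  qed
  moreover have "qpoch (\<zeta> ^ 2) (\<zeta> ^ 2) (2 * N) \<noteq> 0"
    using ord2[of "Suc j" for j] nN by (auto simp: qpoch_eq_0_iff)
  moreover have "qpoch \<zeta> \<zeta> (2 * N) \<noteq> 0"
    using \<zeta>(2)[of "Suc j" for j] nN by (auto simp: qpoch_eq_0_iff)
  ultimately show ?thesis
    using sum_common_num[of a \<zeta> N] a \<zeta>(2)[of 1] n unfolding N_def[symmetric] by auto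
qed

text \<open>Writing \<open>n = 2 * N + 1\<close>, the condition \<open>a * q ^ n = 1\<close> reads
  \<open>(a * q) * (q ^ 2) ^ N = 1\<close>, and \<open>n mod 6 = 5\<close> gives
  \<open>N mod 3 = 2\<close>. The other root follows from the symmetry between \<open>a\<close> and
  \<open>1 / a\<close>.\<close>

lemma sum_common_num_terminating:
  fixes q a :: "'a::field"
  assumes n: "n mod 6 = 5" and q: "q \<noteq> 0" "\<And>j. 0 < j \<Longrightarrow> q ^ j \<noteq> 1"
    and a: "a * q ^ n = 1 \<or> a = q ^ n"
  shows "(\<Sum>k\<le>(n - 1) div 2. common_num q a ((n - 1) div 2) k) = 0"
proof -
  define N where "N = (n - 1) div 2"
  have nN: "n = 2 * N + 1" and N: "N mod 3 = 2" using n unfolding N_def by presburger+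
  have a0: "a \<noteq> 0" using a q(1) by auto
  have q2: "(q ^ 2) ^ j \<noteq> 1" if "0 < j" for j using q(2)[of "2 * j"] that by (simp add: power_mult)
  have *: "cubic_sum (q ^ 2) (c * q) (q / c) q N = 0" if c: "c * q ^ n = 1" for c
  proof (rule cubic_sum_terminating_eq_0[OF _ _ N q2])
    show "c * q * (q / c) = q ^ 2" using c by (auto simp: power2_eq_square)
    show "c * q * (q ^ 2) ^ N = 1" using c unfolding nN by (simp add: mult_ac flip: power_mult)
  qed
  have "cubic_sum (q ^ 2) (a * q) (q / a) q N = 0"
    using a
  proof
    assume a: "a = q ^ n"
    have "cubic_sum (q ^ 2) (1 / a * q) (q / (1 / a)) q N = 0"
      using q(1) by (intro *) (simp add: a)
    thus ?thesis by (subst cubic_sum_commute) (simp add: mult_ac)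
  qed (rule *)
  moreover have "qpoch (q ^ 2) (q ^ 2) (2 * N) \<noteq> 0"
    using q2[of "Suc j" for j] by (auto simp: qpoch_eq_0_iff)
  moreover have "qpoch q q (2 * N) \<noteq> 0"
    using q(2)[of "Suc j" for j] by (auto simp: qpoch_eq_0_iff)
  ultimately show ?thesis
    using sum_common_num[of a q N] a0 q(2)[of 1] unfolding N_def[symmetric] by auto
qed

section \<open>Divisibility and coprimality in the polynomial ring\<close>

locale ring_morphism =
  fixes h :: "'a::comm_ring_1 \<Rightarrow> 'b::comm_ring_1"
  assumes hom_add: "h (x + y) = h x + h y"
    and hom_mult: "h (x * y) = h x * h y"
    and hom_one: "h 1 = 1"
begin

lemma hom_zero: "h 0 = 0"
  using hom_add[of 0 0] by simp

lemma hom_uminus: "h (- x) = - h x"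
  using hom_add[of x "- x"] by (simp add: hom_zero eq_neg_iff_add_eq_0 add.commute)

lemma hom_diff: "h (x - y) = h x - h y"
  using hom_add[of x "- y"] by (simp add: hom_uminus)

lemma hom_sum: "h (sum f A) = (\<Sum>x\<in>A. h (f x))"
  by (induction A rule: infinite_finite_induct) (simp_all add: hom_zero hom_add)

lemma hom_prod: "h (prod f A) = (\<Prod>x\<in>A. h (f x))"
  by (induction A rule: infinite_finite_induct) (simp_all add: hom_one hom_mult)

lemma hom_power: "h (x ^ k) = h x ^ k"
  by (induction k) (simp_all add: hom_one hom_mult)

lemmas hom_simps = hom_add hom_mult hom_one hom_zero hom_diff hom_sum hom_prod hom_power

text \<open>Being division-free, the numerator commutes with every substitution for \<open>q\<close>
  and \<open>a\<close>; its divisors are later detected at special values.\<close>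

lemma hom_common_num: "h (common_num q a K k) = common_num (h q) (h a) K k"
  by (simp add: common_num_def qint_def sym_poch_def qpoch_def hom_simps)

lemma hom_common_den: "h (common_den q a K) = common_den (h q) (h a) K"
  by (simp add: common_den_def sym_poch_def qpoch_def hom_simps)

lemma poly_map_poly_morphism: "ring_morphism (\<lambda>p. poly (map_poly h p) c)"
proof
  fix p r :: "'a poly"
  have "map_poly h (p + r) = map_poly h p + map_poly h r"
    by (intro poly_eqI) (simp add: coeff_map_poly hom_simps)
  thus "poly (map_poly h (p + r)) c = poly (map_poly h p) c + poly (map_poly h r) c" by simp
  have "map_poly h (p * r) = map_poly h p * map_poly h r"
    by (intro poly_eqI) (simp add: coeff_map_poly coeff_mult hom_simps)
  thus "poly (map_poly h (p * r)) c = poly (map_poly h p) c * poly (map_poly h r) c" by simp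
qed (simp add: hom_one)

end

lemma ring_morphism_to_fract: "ring_morphism (to_fract :: 'a::idom \<Rightarrow> 'a fract)"
  by standard simp_all

lemma ring_morphism_of_int: "ring_morphism (of_int :: int \<Rightarrow> 'a::comm_ring_1)"
  by standard simp_all

abbreviation int_poly_eval :: "complex \<Rightarrow> int poly \<Rightarrow> complex" where
  "int_poly_eval z p \<equiv> poly (map_poly of_int p) z"

lemma ring_morphism_int_poly_eval: "ring_morphism (int_poly_eval z)"
  by (rule ring_morphism.poly_map_poly_morphism[OF ring_morphism_of_int])

lemma prod_linear_factors_dvd:
  fixes p :: "'a::idom poly"
  assumes "finite A" and "\<And>z. z \<in> A \<Longrightarrow> poly p z = 0"
  shows "(\<Prod>z\<in>A. [:-z, 1:]) dvd p"
  using assms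
proof (induction A)
  case (insert z A)
  then obtain r where r: "p = (\<Prod>z\<in>A. [:-z, 1:]) * r" by (auto elim: dvdE)
  have "poly (\<Prod>z\<in>A. [:-z, 1:]) z \<noteq> 0"
    using insert.hyps by (auto simp: poly_prod)
  moreover have "poly p z = 0" using insert.prems by simp
  ultimately have "[:-z, 1:] dvd r" by (simp add: r poly_eq_0_iff_dvd)
  hence "[:-z, 1:] * (\<Prod>z\<in>A. [:-z, 1:]) dvd r * (\<Prod>z\<in>A. [:-z, 1:])" by (rule mult_dvd_mono) simp
  thus ?case using insert.hyps by (simp add: r mult_ac)
qed simp

lemma monic_cyclotomic: "n > 0 \<Longrightarrow> lead_coeff (cyclotomic n) = 1"
  using lead_coeff_cyclotomic_complex[of n]
  by (simp flip: of_int_cyclotomic add: degree_map_poly_of_int coeff_map_poly)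

text \<open>Division with remainder by a monic polynomial stays over the integers. Over the complex
  numbers the remainder is divisible by a polynomial of larger degree, hence zero.\<close>

lemma cyclotomic_dvdI:
  assumes n: "n > 0" and zero: "\<And>z. z \<in> primitive_roots_unity n \<Longrightarrow> int_poly_eval z p = 0"
  shows "cyclotomic n dvd p"
proof -
  have "cyclotomic n \<noteq> 0" using monic_cyclotomic[OF n] by auto
  obtain q r where qr: "pseudo_divmod p (cyclotomic n) = (q, r)"
    by (cases "pseudo_divmod p (cyclotomic n)")
  have eq: "p = cyclotomic n * q + r" and r: "r = 0 \<or> degree r < degree (cyclotomic n)"
    using pseudo_divmod[OF \<open>cyclotomic n \<noteq> 0\<close> qr] monic_cyclotomic[OF n] by simp_all
  have "cyclotomic_complex n dvd map_poly of_int p"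
    unfolding cyclotomic_complex_def using zero finite_primitive_roots_unity[OF n]
    by (intro prod_linear_factors_dvd) auto
  hence "cyclotomic_complex n dvd map_poly of_int r"
    unfolding eq map_poly_of_int_add map_poly_of_int_mult of_int_cyclotomic[OF n]
    by (simp add: dvd_add_right_iff)
  moreover have "degree (cyclotomic_complex n) = degree (cyclotomic n)"
    by (simp flip: of_int_cyclotomic[OF n] add: degree_map_poly_of_int)
  ultimately have "map_poly (of_int :: int \<Rightarrow> complex) r = 0"
    using r dvd_imp_degree_le[of "cyclotomic_complex n" "map_poly of_int r"]
    by (force simp: degree_map_poly_of_int)
  hence "r = 0" using map_poly_of_int_inj[of r 0] by simp
  thus ?thesis by (simp add: eq)
qed

lemma int_poly_eval_cyclotomic_eq_0_iff:
  "n > 0 \<Longrightarrow> int_poly_eval z (cyclotomic n) = 0 \<longleftrightarrow> z \<in> primitive_roots_unity n"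
  by (simp add: of_int_cyclotomic cyclotomic_complex_def poly_prod finite_primitive_roots_unity)

text \<open>A common divisor has a unit as leading coefficient, and a nonconstant one would have a
  complex root shared by \<open>p\<close> and \<open>r\<close>.\<close>

lemma coprime_monic_int_polyI:
  fixes p r :: "int poly"
  assumes "lead_coeff p = 1" and "\<And>z. int_poly_eval z p = 0 \<Longrightarrow> int_poly_eval z r \<noteq> 0"
  shows "coprime p r"
proof (rule coprimeI)
  fix g assume g: "g dvd p" "g dvd r"
  then obtain u v where uv: "p = g * u" "r = g * v" by (auto elim!: dvdE)
  have "lead_coeff g * lead_coeff u = 1" using assms(1) by (simp add: uv lead_coeff_mult)
  hence unit: "is_unit (lead_coeff g)" by (metis dvd_triv_left)
  have "degree g = 0"
  proof (rule ccontr)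
    assume "degree g \<noteq> 0"
    hence "\<not> constant (poly (map_poly (of_int :: int \<Rightarrow> complex) g))"
      by (simp add: constant_degree degree_map_poly_of_int)
    then obtain z where "int_poly_eval z g = 0"
      using fundamental_theorem_of_algebra by blast
    hence "int_poly_eval z p = 0" "int_poly_eval z r = 0"
      by (simp_all add: uv map_poly_of_int_mult)
    thus False using assms(2) by blast
  qed
  thus "is_unit g" using unit by (auto elim!: degree_eq_zeroE simp: is_unit_const_poly_iff)
qed

text \<open>A divisor of \<open>[:c:]\<close> is constant in the outer variable, so it divides every
  coefficient of \<open>p\<close>, among them a unit.\<close>

lemma coprime_const_polyI:
  fixes c :: "int poly" and p :: "int poly poly"
  assumes "c \<noteq> 0" and "is_unit (coeff p i)"
  shows "coprime [:c:] p"
proof (rule coprimeI)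
  fix g assume g: "g dvd [:c:]" "g dvd p"
  hence "degree g = 0" using dvd_imp_degree_le[of g "[:c:]"] assms(1) by simp
  then obtain d where d: "g = [:d:]" by (auto elim: degree_eq_zeroE)
  hence "d dvd coeff p i" using g(2) by (simp add: const_poly_dvd_iff)
  thus "is_unit g" using assms(2) dvd_trans by (auto simp: d is_unit_const_poly_iff)
qed

lemma coprime_const_const_poly:
  fixes c d :: "int poly"
  assumes "coprime c d" and "c \<noteq> 0"
  shows "coprime [:c:] [:d:]"
proof (rule coprimeI)
  fix g assume g: "g dvd [:c:]" "g dvd [:d:]"
  hence "degree g = 0" using dvd_imp_degree_le[of g "[:c:]"] assms(2) by simp
  then obtain e where e: "g = [:e:]" by (auto elim: degree_eq_zeroE)
  thus "is_unit g" using g assms(1) by (auto simp: is_unit_const_poly_iff intro: coprime_common_divisor)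
qed

text \<open>Eliminating the outer variable shows that a common divisor divides a nonzero constant,
  as in \<open>coprime_const_polyI\<close>.\<close>

lemma coprime_combinationI:
  fixes p :: "int poly poly"
  assumes "u * p + v * r = [:c:]" and "c \<noteq> 0" and "is_unit (coeff p i)"
  shows "coprime p r"
proof (rule coprimeI)
  fix g assume g: "g dvd p" "g dvd r"
  hence "g dvd [:c:]" unfolding assms(1)[symmetric] by simp
  with coprime_const_polyI[OF assms(2,3)] show "is_unit g" using g(1) by (rule coprime_common_divisor)
qed

text \<open>If \<open>u / v\<close> is the reduced form, then \<open>u * D = N * v\<close>, and
  coprimality with \<open>D\<close> moves the divisor \<open>P\<close> from \<open>N\<close> to
  \<open>u\<close>. The fraction \<open>N / D\<close> need not be reduced.\<close>

lemma ratfun_cong_0I: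
  assumes S: "S * to_fract D = to_fract N" and "D \<noteq> 0" and "P dvd N" and "coprime P D"
  shows "ratfun_cong S 0 P"
proof -
  obtain u v where uv: "quot_of_fract S = (u, v)" by force
  hence "v \<noteq> 0" "S = to_fract u / to_fract v"
    using snd_quot_of_fract_nonzero[of S] Fract_quot_of_fract[of S] by (auto simp: Fract_conv_to_fract)
  hence "to_fract (u * D) = to_fract (N * v)"
    using S by (auto simp: nonzero_eq_divide_eq mult_ac) (metis mult.left_commute mult.commute)
  hence "u * D = N * v" by (simp only: to_fract_eq_iff)
  hence "P dvd u * D" using assms(3) by simp
  hence "P dvd u" using assms(4) by (simp add: coprime_dvd_mult_left_iff)
  thus ?thesis by (simp add: ratfun_cong_def uv)
qed

section \<open>Coprimality of the moduli and the common denominator\<close>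

lemma q_poly_power: "q_poly ^ k = [:monom 1 k:]"
  by (induction k) (simp_all add: q_poly_def monom_Suc)

lemma one_minus_a_q: "1 - a_poly * q_poly ^ k = [:1, - monom 1 k:]"
  by (simp add: q_poly_power a_poly_def one_pCons)

lemma a_minus_q: "a_poly - q_poly ^ k = [:- monom 1 k, 1:]"
  by (simp add: q_poly_power a_poly_def)

lemma one_minus_q: "1 - q_poly ^ k = [:1 - monom 1 k:]"
  by (simp add: q_poly_power one_pCons)

lemma monom_1_eq_iff: "monom (1::'a::comm_ring_1) i = monom 1 j \<longleftrightarrow> i = j"
  by (auto simp: monom_eq_iff')

lemma one_minus_monom_neq_0: "i > 0 \<Longrightarrow> 1 - monom (1::int) i \<noteq> 0"
  using monom_1_eq_iff[of 0 i, where 'a = int] by auto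

text \<open>Factors \<open>1 - q^j\<close> are constant in \<open>a\<close> and nonzero. For two
  factors containing \<open>a\<close>, eliminating \<open>a\<close> leaves \<open>q^i - q^j\<close>
  or \<open>1 - q^(i + j)\<close>.\<close>

lemma coprime_linear_factors:
  shows "j > 0 \<Longrightarrow> coprime (1 - a_poly * q_poly ^ i) (1 - q_poly ^ j)"
    and "j > 0 \<Longrightarrow> coprime (a_poly - q_poly ^ i) (1 - q_poly ^ j)"
    and "i \<noteq> j \<Longrightarrow> coprime (1 - a_poly * q_poly ^ i) (1 - a_poly * q_poly ^ j)"
    and "i \<noteq> j \<Longrightarrow> coprime (a_poly - q_poly ^ i) (a_poly - q_poly ^ j)"
    and "i + j > 0 \<Longrightarrow> coprime (1 - a_poly * q_poly ^ i) (a_poly - q_poly ^ j)"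
    and "i + j > 0 \<Longrightarrow> coprime (a_poly - q_poly ^ j) (1 - a_poly * q_poly ^ i)"
proof -
  assume j: "j > 0"
  show "coprime (1 - a_poly * q_poly ^ i) (1 - q_poly ^ j)"
    unfolding one_minus_a_q one_minus_q using j one_minus_monom_neq_0
    by (subst coprime_commute, intro coprime_const_polyI[of _ _ 0]) auto
  show "coprime (a_poly - q_poly ^ i) (1 - q_poly ^ j)"
    unfolding a_minus_q one_minus_q using j one_minus_monom_neq_0
    by (subst coprime_commute, intro coprime_const_polyI[of _ _ 1]) auto
next
  assume ij: "i \<noteq> j"
  have "(- (q_poly ^ j)) * (1 - a_poly * q_poly ^ i) + q_poly ^ i * (1 - a_poly * q_poly ^ j) = [:monom 1 i - monom 1 j:]"
    unfolding q_poly_power[of i] q_poly_power[of j] by (simp add: algebra_simps)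
  thus "coprime (1 - a_poly * q_poly ^ i) (1 - a_poly * q_poly ^ j)"
    by (rule coprime_combinationI[of _ _ _ _ _ 0]) (use ij in \<open>auto simp: one_minus_a_q monom_1_eq_iff\<close>)
  have "- 1 * (a_poly - q_poly ^ i) + 1 * (a_poly - q_poly ^ j) = [:monom 1 i - monom 1 j:]"
    unfolding q_poly_power[of i] q_poly_power[of j] by simp
  thus "coprime (a_poly - q_poly ^ i) (a_poly - q_poly ^ j)"
    by (rule coprime_combinationI[of _ _ _ _ _ 1]) (use ij in \<open>auto simp: a_minus_q monom_1_eq_iff\<close>)
next
  assume ij: "i + j > 0"
  have "1 * (1 - a_poly * q_poly ^ i) + q_poly ^ i * (a_poly - q_poly ^ j) = 1 - q_poly ^ (i + j)"
    by (simp add: algebra_simps power_add)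
  also have "\<dots> = [:1 - monom 1 (i + j):]" by (rule one_minus_q)
  finally show *: "coprime (1 - a_poly * q_poly ^ i) (a_poly - q_poly ^ j)"
    by (rule coprime_combinationI[of _ _ _ _ _ 0]) (use ij one_minus_monom_neq_0 in \<open>auto simp: one_minus_a_q\<close>)
  show "coprime (a_poly - q_poly ^ j) (1 - a_poly * q_poly ^ i)"
    using * by (simp only: coprime_commute)
qed

text \<open>The first two parts hold because the linear factors have a unit coefficient; the third
  because a primitive \<open>n\<close>-th root of unity is no root of \<open>1 - q^j\<close> unless
  \<open>n\<close> divides \<open>j\<close>.\<close>

lemma coprime_cyclotomic_q:
  assumes n: "n > 0"
  shows "coprime (cyclotomic_q n) (1 - a_poly * q_poly ^ j)"
    and "coprime (cyclotomic_q n) (a_poly - q_poly ^ j)"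
    and "\<not> n dvd j \<Longrightarrow> coprime (cyclotomic_q n) (1 - q_poly ^ j)"
proof -
  have "cyclotomic n \<noteq> 0" using monic_cyclotomic[OF n] by auto
  show "coprime (cyclotomic_q n) (1 - a_poly * q_poly ^ j)"
    unfolding one_minus_a_q cyclotomic_q_def using \<open>cyclotomic n \<noteq> 0\<close>
    by (intro coprime_const_polyI[of _ _ 0]) auto
  show "coprime (cyclotomic_q n) (a_poly - q_poly ^ j)"
    unfolding a_minus_q cyclotomic_q_def using \<open>cyclotomic n \<noteq> 0\<close>
    by (intro coprime_const_polyI[of _ _ 1]) auto
  assume j: "\<not> n dvd j"
  have "coprime (cyclotomic n) (1 - monom 1 j)"
  proof (rule coprime_monic_int_polyI[OF monic_cyclotomic[OF n]])
    fix z assume "int_poly_eval z (cyclotomic n) = 0"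
    hence z: "z ^ n = 1" "\<And>m. 0 < m \<Longrightarrow> m < n \<Longrightarrow> z ^ m \<noteq> 1"
      unfolding int_poly_eval_cyclotomic_eq_0_iff[OF n] by (auto simp: primitive_roots_unity_def)
    have "z ^ j = (z ^ n) ^ (j div n) * z ^ (j mod n)" by (simp flip: power_mult power_add)
    hence "z ^ j \<noteq> 1" using z(1) z(2)[of "j mod n"] j n by (auto simp: dvd_eq_mod_eq_0)
    moreover have "map_poly of_int (1 - monom 1 j :: int poly) = (1 - monom 1 j :: complex poly)"
      by (intro poly_eqI) (simp add: coeff_map_poly coeff_1)
    ultimately show "int_poly_eval z (1 - monom 1 j) \<noteq> 0"
      by (simp add: poly_monom)
  qed
  thus "coprime (cyclotomic_q n) (1 - q_poly ^ j)"
    unfolding one_minus_q cyclotomic_q_def using \<open>cyclotomic n \<noteq> 0\<close> by (rule coprime_const_const_poly)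
qed

lemma coprime_common_denI:
  assumes "\<And>j. j < 2 * K \<Longrightarrow> coprime P (1 - q_poly ^ Suc j)"
    and "\<And>j. j < 2 * K \<Longrightarrow> coprime P (1 - q_poly ^ (2 * Suc j))"
    and "\<And>j. coprime P (1 - a_poly * q_poly ^ (6 * Suc j))"
    and "\<And>j. coprime P (a_poly - q_poly ^ (6 * Suc j))"
  shows "coprime P (common_den q_poly a_poly K)"
proof -
  have "q_poly ^ 6 * (q_poly ^ 6) ^ j = q_poly ^ (6 * Suc j)" "q_poly ^ 2 * (q_poly ^ 2) ^ j = q_poly ^ (2 * Suc j)"
    "q_poly * q_poly ^ j = q_poly ^ Suc j" for j
    by (simp_all only: power_mult power_Suc)
  thus ?thesis unfolding common_den_def sym_poch_def qpoch_def
    using assms by (auto simp only: coprime_mult_right_iff intro!: prod_coprime_right)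
qed

section \<open>Divisors of the common numerator found by specialization\<close>

lemma eval_q_poly: "ring_morphism h \<Longrightarrow> poly (map_poly h q_poly) c = h [:0, 1:]"
  by (simp add: q_poly_def map_poly_pCons ring_morphism.hom_zero)

lemma eval_a_poly: "ring_morphism h \<Longrightarrow> poly (map_poly h a_poly) c = c"
  by (simp add: a_poly_def map_poly_pCons ring_morphism.hom_zero ring_morphism.hom_one)

lemma eval_common_num:
  assumes "ring_morphism h"
  shows "poly (map_poly h (\<Sum>k\<le>K. common_num q_poly a_poly K k)) c = (\<Sum>k\<le>K. common_num (h [:0, 1:]) c K k)"
proof -
  interpret ring_morphism "\<lambda>p. poly (map_poly h p) c"
    using assms by (rule ring_morphism.poly_map_poly_morphism)
  show ?thesis
    by (simp add: hom_sum hom_common_num eval_q_poly[OF assms] eval_a_poly[OF assms])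
qed

text \<open>Divisibility is tested on each coefficient with respect to \<open>a\<close>. At a
  primitive root of unity the numerator is a complex polynomial in \<open>a\<close> that vanishes at
  all nonzero points, so all its coefficients are zero.\<close>

lemma cyclotomic_q_dvd_num:
  assumes n: "n > 1" "coprime n 6"
  shows "cyclotomic_q n dvd (\<Sum>k\<le>(n - 1) div 2. common_num q_poly a_poly ((n - 1) div 2) k)" (is "_ dvd ?N")
  unfolding cyclotomic_q_def const_poly_dvd_iff
proof (intro allI cyclotomic_dvdI)
  fix i z assume "z \<in> primitive_roots_unity n"
  hence z: "z ^ n = 1" "\<And>m. 0 < m \<Longrightarrow> m < n \<Longrightarrow> z ^ m \<noteq> 1"
    by (auto simp: primitive_roots_unity_def)
  let ?p = "map_poly (int_poly_eval z) ?N"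
  have "poly ?p c = 0" if "c \<noteq> 0" for c
    unfolding eval_common_num[OF ring_morphism_int_poly_eval]
    using sum_common_num_root_of_unity[OF n z that] by (simp add: map_poly_pCons)
  hence "- {0} \<subseteq> {c. poly ?p c = 0}" by auto
  moreover have "infinite (- {0 :: complex})" by (simp add: infinite_UNIV_char_0)
  ultimately have "infinite {c. poly ?p c = 0}" using finite_subset by blast
  hence "?p = 0" using poly_roots_finite by blast
  hence "coeff ?p i = 0" by simp
  thus "int_poly_eval z (coeff ?N i) = 0" by (simp add: coeff_map_poly)
qed (use n in simp)

text \<open>Gauss's lemma: a root in the fraction field gives divisibility there, and it descends
  because a unit coefficient makes the linear polynomial primitive.\<close>

lemma fract_poly_linear_dvd:
  fixes p :: "int poly poly"
  assumes "is_unit (coeff [:c, d:] i)" and "d \<noteq> 0" and "poly (fract_poly p) (- to_fract c / to_fract d) = 0"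
  shows "[:c, d:] dvd p"
proof (rule fract_poly_dvdD)
  have "[:to_fract c / to_fract d, 1:] dvd fract_poly p"
    using assms(3) unfolding poly_eq_0_iff_dvd by simp
  moreover have "fract_poly [:c, d:] = smult (to_fract d) [:to_fract c / to_fract d, 1:]"
    using assms(2) by (simp add: map_poly_pCons)
  ultimately show "fract_poly [:c, d:] dvd fract_poly p"
    using assms(2) by (metis smult_dvd to_fract_eq_0_iff)
  have "content [:c, d:] dvd coeff [:c, d:] i" by (rule content_dvd_coeff)
  hence "is_unit (content [:c, d:])" using assms(1) dvd_trans by blast
  thus "content [:c, d:] = 1" by simp
qed

text \<open>Over the field of fractions in \<open>q\<close>, where \<open>q\<close> is not a root of
  unity, the two factors have the roots \<open>a = q^(-n)\<close> and
  \<open>a = q^n\<close>.\<close>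

lemma linear_factors_dvd_num:
  assumes n: "n mod 6 = 5"
  shows "1 - a_poly * q_poly ^ n dvd (\<Sum>k\<le>(n - 1) div 2. common_num q_poly a_poly ((n - 1) div 2) k)" (is "_ dvd ?N")
    and "a_poly - q_poly ^ n dvd (\<Sum>k\<le>(n - 1) div 2. common_num q_poly a_poly ((n - 1) div 2) k)"
proof -
  let ?q = "to_fract [:0, 1 :: int:]"
  have q: "?q ^ j = to_fract (monom 1 j)" for j
    by (induction j) (simp_all add: monom_Suc flip: to_fract_mult)
  have "?q \<noteq> 0" by simp
  moreover have "?q ^ j \<noteq> 1" if "0 < j" for j
    using that monom_1_eq_iff[of j 0, where 'a = int] unfolding q to_fract_1[symmetric] to_fract_eq_iff by simp
  ultimately have root: "poly (fract_poly ?N) c = 0" if "c * ?q ^ n = 1 \<or> c = ?q ^ n" for c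
    unfolding eval_common_num[OF ring_morphism_to_fract] using sum_common_num_terminating[OF n _ _ that] by blast
  show "1 - a_poly * q_poly ^ n dvd ?N"
    unfolding one_minus_a_q by (rule fract_poly_linear_dvd[of _ _ 0], simp, simp add: monom_eq_0_iff, rule root)
      (simp add: q monom_eq_0_iff)
  show "a_poly - q_poly ^ n dvd ?N"
    unfolding a_minus_q by (rule fract_poly_linear_dvd[of _ _ 1], simp, simp, rule root) (simp add: q)
qed

theorem theorem7p1:
  fixes n :: nat and q a S :: qa_ratfun
  assumes "n > 1" and "coprime n 6"
  defines "q \<equiv> q_var" and "a \<equiv> a_var"
  defines "S \<equiv> (\<Sum>k = 0..(n - 1) div 2.
      qint q (8 * k + 1) *
      (qpochs [a * q, q / a] (q ^ 2) k * qpoch q (q ^ 2) (2 * k) * qpochs [q, q ^ 2] (q ^ 6) k /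
       (qpoch (q ^ 2) (q ^ 2) (2 * k) * qpochs [a * q ^ 6, q ^ 6 / a] (q ^ 6) k *
        qpoch q q (2 * k))) *
      q ^ (2 * k))"
  shows "([n = 1] (mod 6) \<longrightarrow> ratfun_cong S 0 (cyclotomic_q n)) \<and>
         ([n = 5] (mod 6) \<longrightarrow>
            ratfun_cong S 0
              (cyclotomic_q n * (1 - a_poly * q_poly ^ n) * (a_poly - q_poly ^ n)))"
proof -
  define K where "K = (n - 1) div 2"
  define N where "N = (\<Sum>k\<le>K. common_num q_poly a_poly K k)"
  define D where "D = common_den q_poly a_poly K"
  have "odd n" "\<not> 3 dvd n"
    using assms(1,2) by (auto dest: coprime_common_divisor[of n 6 2] coprime_common_divisor[of n 6 3])
  hence nK: "n = 2 * K + 1" by (auto simp: K_def elim: oddE)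
  have cop1: "coprime (cyclotomic_q n) D"
    unfolding D_def
  proof (rule coprime_common_denI)
    fix j assume j: "j < 2 * K"
    \<comment> \<open>The truncation at \<open>(n - 1) div 2\<close> matters here: the exponents
      \<open>Suc j\<close> stay below \<open>n = 2 * K + 1\<close>, and as \<open>n\<close> is odd,
      doubling them is harmless.\<close>
    hence *: "\<not> n dvd Suc j" by (auto simp: nK dest: dvd_imp_le)
    thus "coprime (cyclotomic_q n) (1 - q_poly ^ Suc j)"
      using assms(1) by (intro coprime_cyclotomic_q) auto
    have "\<not> n dvd 2 * Suc j"
      using * \<open>odd n\<close> coprime_dvd_mult_right_iff[of n 2 "Suc j"] by simp
    thus "coprime (cyclotomic_q n) (1 - q_poly ^ (2 * Suc j))"
      using assms(1) by (intro coprime_cyclotomic_q) auto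
  qed (use assms(1) in \<open>simp_all only: coprime_cyclotomic_q\<close>)
  \<comment> \<open>The denominator contains \<open>1 - a * q^i\<close> and \<open>a - q^i\<close>
    only for multiples \<open>i\<close> of \<open>6\<close>, which the odd \<open>n\<close>
    avoids.\<close>
  have n6: "n \<noteq> 6 * Suc j" for j using \<open>odd n\<close> by auto
  have cop2: "coprime (1 - a_poly * q_poly ^ n) D"
    unfolding D_def using n6 assms(1) by (intro coprime_common_denI coprime_linear_factors) auto
  have cop3: "coprime (a_poly - q_poly ^ n) D"
    unfolding D_def using n6 assms(1)
    by (intro coprime_common_denI coprime_linear_factors) auto
  \<comment> \<open>Otherwise \<open>1 - a_poly * q_poly ^ n\<close> would be coprime to zero and
    hence a unit.\<close>
  have "D \<noteq> 0"
    using cop2 by (auto simp: one_minus_a_q is_unit_poly_iff monom_eq_0_iff)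
  interpret ring_morphism "to_fract :: qa_poly \<Rightarrow> qa_ratfun" by (rule ring_morphism_to_fract)
  have "S = (\<Sum>k\<le>K. common_num q a K k / common_den q a K)"
    unfolding S_def K_def[symmetric] atLeast0AtMost
  proof (intro sum.cong refl summand_common_den)
    show "common_den q a K \<noteq> 0"
      using \<open>D \<noteq> 0\<close> by (simp add: D_def q_def a_def q_var_def a_var_def flip: hom_common_den)
    show "a \<noteq> 0" by (simp add: a_def a_var_def a_poly_def)
  qed auto
  hence S: "S * to_fract D = to_fract N"
    using \<open>D \<noteq> 0\<close> unfolding D_def N_def hom_sum hom_common_num hom_common_den q_def a_def q_var_def a_var_def
    by (simp add: hom_common_den[symmetric] flip: sum_divide_distrib)
  have dvd1: "cyclotomic_q n dvd N"
    unfolding N_def K_def using assms(1,2) by (rule cyclotomic_q_dvd_num)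
  show ?thesis
  proof (intro conjI impI)
    show "ratfun_cong S 0 (cyclotomic_q n)"
      using S \<open>D \<noteq> 0\<close> dvd1 cop1 by (rule ratfun_cong_0I)
  next
    assume "[n = 5] (mod 6)"
    hence n5: "n mod 6 = 5" by (simp add: cong_def)
    have "cyclotomic_q n * (1 - a_poly * q_poly ^ n) dvd N"
      using dvd1 linear_factors_dvd_num(1)[OF n5] assms(1) unfolding N_def K_def
      by (intro divides_mult coprime_cyclotomic_q) auto
    hence "cyclotomic_q n * (1 - a_poly * q_poly ^ n) * (a_poly - q_poly ^ n) dvd N"
      using linear_factors_dvd_num(2)[OF n5] assms(1) unfolding N_def K_def
      by (intro divides_mult) (auto simp: coprime_mult_left_iff intro!: coprime_cyclotomic_q coprime_linear_factors)
    moreover have "coprime (cyclotomic_q n * (1 - a_poly * q_poly ^ n) * (a_poly - q_poly ^ n)) D"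
      using cop1 cop2 cop3 by (simp add: coprime_mult_left_iff)
    ultimately show "ratfun_cong S 0 (cyclotomic_q n * (1 - a_poly * q_poly ^ n) * (a_poly - q_poly ^ n))"
      using S \<open>D \<noteq> 0\<close> by (intro ratfun_cong_0I)
  qed
qed

end
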